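(* For all integers $d \geq 1$ and $p \geq 2$, define \[ q(z) = \sum_{k=0}^d (-1)^k \binom{d}{k} z^{p^k}. \] Let $s > 0$ be the smallest (positive) real number such that $q'(s) = 0$. Then for $n \equiv 1 \pmod{p-1}$, \[ C_{d,p}(n) \,\sim\, \frac{p-1}{ \sqrt{ -2\pi q''(s)}} \, n^{-3/2} \, q(s)^{\frac12-n}, \] where $\sim$ means that the ratio of the two sides tends to $1$ as $n\to\infty$ through the integers $n\equiv 1 \pmod{p-1}$.
   Context: Fix integers $d\ge 1$ and $p\ge 2$. For an open rectangle $R=(a_1,b_1)\times\cdots\times(a_d,b_d)\subseteq(0,1)^d$ and $1\le i\le d$, put $c_i(j)=a_i+\frac{j}{p}(b_i-a_i)$ for $0\le j\le p$. The $p$-splitting of $R$ in the coordinate $i$ is the set of $p$ open rectangles \[ H_i(R)=\{(a_1,b_1)\times\cdots\times(c_i(j-1),c_i(j))\times\cdots\times(a_d,b_d) : 1\le j\le p\}, \] where only the $i$-th factor is changed. Fix an integer $m\ge 0$, start with $S_0=\{(0,1)^d\}$, and for $k=1,\dots,m$ choose any $R\in S_{k-1}$ and any $1\le i\le d$ and set $S_k=(S_{k-1}\setminus\{R\})\cup H_i(R)$. Any resulting set $S_m$ is called a $(d,p,n)$-decomposition, where $n=1+m(p-1)=|S_m|$. $C_{d,p}(n)$ denotes the number of distinct $(d,p,n)$-decompositions (as sets of rectangles). *)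

theory Defs
  imports "HOL-Analysis.Analysis" "HOL-Number_Theory.Cong"
begin

text \<open>Points of $d$-space are functions on the coordinates $1,\dots,d$, extensional outside
  of them.\<close>

definition rectangle :: "nat \<Rightarrow> (nat \<Rightarrow> real) \<Rightarrow> (nat \<Rightarrow> real) \<Rightarrow> (nat \<Rightarrow> real) set" where
  "rectangle d a b = (\<Pi>\<^sub>E i\<in>{1..d}. {a i<..<b i})"

definition cut_point :: "nat \<Rightarrow> (nat \<Rightarrow> real) \<Rightarrow> (nat \<Rightarrow> real) \<Rightarrow> nat \<Rightarrow> nat \<Rightarrow> real" where
  "cut_point p a b i j = a i + real j / real p * (b i - a i)"

definition splitting ::
    "nat \<Rightarrow> nat \<Rightarrow> nat \<Rightarrow> (nat \<Rightarrow> real) \<Rightarrow> (nat \<Rightarrow> real) \<Rightarrow> (nat \<Rightarrow> real) set set" where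
  "splitting d p i a b =
     (\<lambda>j. rectangle d (a(i := cut_point p a b i (j - 1))) (b(i := cut_point p a b i j))) ` {1..p}"

text \<open>\<open>reachable d p m S\<close>: the set \<open>S\<close> of rectangles arises from the unit cube by \<open>m\<close>
  splittings. A rectangle with \<open>a i < b i\<close> for all coordinates determines its end points, so
  the splitting depends only on the rectangle and the coordinate.\<close>

inductive reachable :: "nat \<Rightarrow> nat \<Rightarrow> nat \<Rightarrow> (nat \<Rightarrow> real) set set \<Rightarrow> bool" for d p where
  start: "reachable d p 0 {rectangle d (\<lambda>_. 0) (\<lambda>_. 1)}"
| split: "reachable d p (Suc m) (S - {rectangle d a b} \<union> splitting d p i a b)"
    if "reachable d p m S" "\<forall>l\<in>{1..d}. a l < b l" "rectangle d a b \<in> S" "i \<in> {1..d}"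

definition decompositions :: "nat \<Rightarrow> nat \<Rightarrow> nat \<Rightarrow> (nat \<Rightarrow> real) set set set" where
  "decompositions d p n = {S. \<exists>m. n = 1 + m * (p - 1) \<and> reachable d p m S}"

definition C :: "nat \<Rightarrow> nat \<Rightarrow> nat \<Rightarrow> nat" where
  "C d p n = card (decompositions d p n)"

definition q :: "nat \<Rightarrow> nat \<Rightarrow> real \<Rightarrow> real" where
  "q d p z = (\<Sum>k=0..d. (-1) ^ k * real (d choose k) * z ^ (p ^ k))"

definition smallest_critical_point :: "(real \<Rightarrow> real) \<Rightarrow> real \<Rightarrow> bool" where
  "smallest_critical_point f s \<longleftrightarrow>
     s > 0 \<and> deriv f s = 0 \<and> (\<forall>t>0. deriv f t = 0 \<longrightarrow> s \<le> t)"


text \<open>The notions above are not degenerate: only finitely many decompositions are counted,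
  and the smallest positive critical point of \<open>q\<close> exists.\<close>

lemma rectangle_eq_imp:
  assumes "rectangle d a b = rectangle d a' b'" "\<forall>l\<in>{1..d}. a l < b l" "l \<in> {1..d}"
  shows "a l = a' l \<and> b l = b' l"
proof -
  have "{a k<..<b k} \<noteq> {}" if "k \<in> {1..d}" for k
    using bspec[OF assms(2) that] by simp
  hence ne: "rectangle d a b \<noteq> {}"
    unfolding rectangle_def PiE_eq_empty_iff by blast
  have "\<forall>k\<in>{1..d}. {a k<..<b k} = {a' k<..<b' k}"
    using assms(1) ne unfolding rectangle_def by (subst (asm) PiE_eq_iff) auto
  hence eq: "{a l<..<b l} = {a' l<..<b' l}" and lt: "a l < b l"
    using assms(2,3) by auto
  have "a' l < b' l" using eq lt by (metis greaterThanLessThan_empty_iff not_le)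
  hence "a' l \<le> a l \<and> b l \<le> b' l" "a l \<le> a' l \<and> b' l \<le> b l"
    using eq lt greaterThanLessThan_subseteq_greaterThanLessThan[of "a l" "b l" "a' l" "b' l"]
      greaterThanLessThan_subseteq_greaterThanLessThan[of "a' l" "b' l" "a l" "b l"] by auto
  thus ?thesis by linarith
qed

lemma splitting_cong:
  assumes "\<And>l. l \<in> {1..d} \<Longrightarrow> a l = a' l \<and> b l = b' l" "i \<in> {1..d}"
  shows "splitting d p i a b = splitting d p i a' b'"
proof -
  have "cut_point p a b i j = cut_point p a' b' i j" for j
    using assms by (simp add: cut_point_def)
  thus ?thesis
    unfolding splitting_def rectangle_def using assms(1)
    by (intro image_cong PiE_cong) auto
qed

lemma splitting_well_defined:
  assumes "rectangle d a b = rectangle d a' b'" "\<forall>l\<in>{1..d}. a l < b l" "i \<in> {1..d}"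
  shows "splitting d p i a b = splitting d p i a' b'"
  using assms by (intro splitting_cong rectangle_eq_imp) auto

lemma finite_reachable: "reachable d p m S \<Longrightarrow> finite S"
  by (induction rule: reachable.induct) (auto simp: splitting_def)

lemma finite_reachable_sets: "finite {S. reachable d p m S}"
proof (induction m)
  case 0
  have "{S. reachable d p 0 S} \<subseteq> {{rectangle d (\<lambda>_. 0) (\<lambda>_. 1)}}"
    by (auto elim: reachable.cases)
  thus ?case by (rule finite_subset) simp
next
  case (Suc m)
  define ends where "ends = (\<lambda>R. SOME e. (\<forall>l\<in>{1..d}. fst e l < snd e l) \<and>
    R = rectangle d (fst e) (snd e))"
  define split_at where
    "split_at R i = splitting d p i (fst (ends R)) (snd (ends R))" for R i
  have *: "splitting d p i a b = split_at (rectangle d a b) i"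
    if R: "\<forall>l\<in>{1..d}. a l < b l" "i \<in> {1..d}" for a b i
  proof -
    have "(\<forall>l\<in>{1..d}. fst (ends (rectangle d a b)) l < snd (ends (rectangle d a b)) l) \<and>
      rectangle d a b = rectangle d (fst (ends (rectangle d a b))) (snd (ends (rectangle d a b)))"
      unfolding ends_def by (rule someI[of _ "(a, b)"]) (simp add: R)
    thus ?thesis unfolding split_at_def using R by (intro splitting_well_defined) blast+
  qed
  have "{S. reachable d p (Suc m) S} \<subseteq>
     (\<Union>S\<in>{S. reachable d p m S}. \<Union>R\<in>S. (\<lambda>i. S - {R} \<union> split_at R i) ` {1..d})"
  proof
    fix T assume "T \<in> {S. reachable d p (Suc m) S}"
    hence "reachable d p (Suc m) T" by simp
    thus "T \<in> (\<Union>S\<in>{S. reachable d p m S}. \<Union>R\<in>S.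
        (\<lambda>i. S - {R} \<union> split_at R i) ` {1..d})"
    proof cases
      case (split S a b i)
      show ?thesis
        unfolding split(1) *[OF split(3,5)] using split(2,4,5) by blast
    qed
  qed
  moreover have "finite \<dots>"
    using Suc finite_reachable by auto
  ultimately show ?case by (rule finite_subset)
qed

lemma finite_decompositions:
  assumes "p \<ge> 2"
  shows "finite (decompositions d p n)"
proof -
  have "decompositions d p n \<subseteq> (\<Union>m\<in>{..n}. {S. reachable d p m S})"
  proof
    fix S assume "S \<in> decompositions d p n"
    then obtain m where m: "n = 1 + m * (p - 1)" "reachable d p m S"
      by (auto simp: decompositions_def)
    have "m * 1 \<le> m * (p - 1)" using assms by (intro mult_le_mono2) simp
    hence "m \<le> n" unfolding m(1) by linarith
    thus "S \<in> (\<Union>m\<in>{..n}. {S. reachable d p m S})" using m(2) by blast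
  qed
  thus ?thesis by (rule finite_subset) (auto intro: finite_reachable_sets)
qed

lemma smallest_critical_point_exists:
  assumes "d \<ge> 1" "p \<ge> 2"
  shows "\<exists>s. smallest_critical_point (q d p) s"
proof -
  define q' where
    "q' z = (\<Sum>k=0..d. (-1) ^ k * real (d choose k) * (real (p ^ k) * z ^ (p ^ k - 1)))" for z :: real
  have der: "(q d p has_real_derivative q' z) (at z)" for z
    unfolding q_def q'_def by (auto intro!: derivative_eq_intros sum.cong)
  have deriv: "deriv (q d p) = q'"
    using der by (intro ext DERIV_imp_deriv)
  have cont: "continuous_on X q'" for X
    unfolding q'_def by (intro continuous_intros)
  have "q' 0 = (\<Sum>k=0..d. if k = 0 then 1 else 0)"
    unfolding q'_def
  proof (rule sum.cong)
    fix k
    have "p ^ k > 1" if "k > 0" using assms(2) that by (intro one_less_power) auto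
    thus "(-1) ^ k * real (d choose k) * (real (p ^ k) * 0 ^ (p ^ k - 1)) = (if k = 0 then 1 else 0)"
      by (auto simp: power_0_left)
  qed simp
  hence q'0: "q' 0 = 1" by simp
  have q0: "q d p 0 = 0" using assms by (simp add: q_def power_0_left)
  have q1: "q d p 1 = 0"
    using assms choose_alternating_sum[of d, where 'a = real]
    by (simp add: q_def atLeast0AtMost)
  have "continuous_on {0..1} (q d p)"
    by (rule DERIV_continuous_on) (rule has_field_derivative_at_within[OF der])
  then obtain z where z: "0 < z" "z < 1" "DERIV (q d p) z :> 0"
    using Rolle[of 0 1 "q d p"] q0 q1 der real_differentiable_def by fastforce
  hence z: "0 < z" "z < 1" "q' z = 0"
    using DERIV_unique der by blast+
  define Z where "Z = {t \<in> {0..1}. q' t = 0}"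
  have "closed Z" unfolding Z_def
    by (intro continuous_closed_preimage_constant cont) auto
  moreover have "bounded Z"
    by (rule bounded_subset[of "{0..1}"]) (auto simp: Z_def)
  ultimately have "compact Z" by (simp add: compact_eq_bounded_closed)
  moreover have "z \<in> Z" using z by (simp add: Z_def)
  ultimately obtain s where s: "s \<in> Z" "\<forall>t\<in>Z. s \<le> t"
    using compact_attains_inf[of Z] by (metis empty_iff)
  have "s > 0" using s q'0 by (cases "s = 0") (auto simp: Z_def)
  moreover have "s \<le> t" if "t > 0" "q' t = 0" for t
    using that s by (cases "t \<le> 1") (auto simp: Z_def)
  ultimately have "smallest_critical_point (q d p) s"
    using s by (auto simp: smallest_critical_point_def deriv Z_def)
  thus ?thesis ..
qed

end

theory Submission
  imports Defs "HOL-Probability.Distributions" "HOL-Complex_Analysis.Complex_Analysis"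
begin

text \<open>A decomposition other than the whole cube can be split first in some nonempty set of
  coordinates, and those that can be split first in every coordinate of a set of size \<open>k\<close> are
  the families of \<open>p\<^sup>k\<close> decompositions of the cells of a grid. Inclusion and
  exclusion give \<open>q(F(x)) = x\<close> for the generating function \<open>F\<close> of
  \<open>C\<close>.

  Write \<open>q(z) = z A(z\<^sup>p\<^sup>-\<^sup>1)\<close>, with \<open>A\<close> the polynomial
  \<open>reduced_q\<close>. Lagrange inversion turns the
  functional equation into \<open>n C(n) = [y\<^sup>m] (1/A(y))\<^sup>n\<close> for
  \<open>n = 1 + m (p - 1)\<close>, which removes the periodicity. The power series \<open>1/A\<close> has
  nonnegative coefficients, by induction on \<open>d\<close> along
  \<open>A\<^sub>d\<^sub>+\<^sub>1(y) = A\<^sub>d(y) - y A\<^sub>d(y\<^sup>p)\<close>. Hence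
  \<open>A\<close> has no complex zero of modulus at most \<open>t = s\<^sup>p\<^sup>-\<^sup>1\<close>, and on
  the circle of radius \<open>t\<close> the modulus of \<open>1/A\<close> has a strict quadratic maximum at
  \<open>t\<close>. The coefficient integral over that circle is evaluated by Laplace's method; its phase is
  stationary at \<open>t\<close> because \<open>q'(s) = 0\<close>, and \<open>q''(s) < 0\<close> is forced by
  the quadratic maximum.\<close>

section \<open>Subdivisions and their generating function\<close>

text \<open>Pascal's rule followed by an index shift. It serves inclusion and exclusion, with
  \<open>g\<close> a power of the generating function, and also the recursion in d of
  \<open>reduced_q\<close>.\<close>

lemma alternating_binomial_sum_Suc:
  fixes g :: "nat \<Rightarrow> 'a::comm_ring_1"
  shows "(\<Sum>k\<le>Suc n. (-1) ^ k * of_nat (Suc n choose k) * g k) =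
    (\<Sum>k\<le>n. (-1) ^ k * of_nat (n choose k) * g k) -
    (\<Sum>k\<le>n. (-1) ^ k * of_nat (n choose k) * g (Suc k))"
proof -
  have "(\<Sum>k\<le>Suc n. (-1) ^ k * of_nat (Suc n choose k) * g k) =
    g 0 + (\<Sum>k\<le>n. (-1) ^ Suc k * of_nat (Suc n choose Suc k) * g (Suc k))"
    by (subst sum.atMost_Suc_shift) simp
  also have "(\<Sum>k\<le>n. (-1) ^ Suc k * of_nat (Suc n choose Suc k) * g (Suc k)) =
    (\<Sum>k\<le>n. (-1) ^ Suc k * of_nat (n choose Suc k) * g (Suc k)) -
    (\<Sum>k\<le>n. (-1) ^ k * of_nat (n choose k) * g (Suc k))"
    unfolding sum_subtractf[symmetric]
  proof (rule sum.cong)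
    fix k
    show "(-1) ^ Suc k * of_nat (Suc n choose Suc k) * g (Suc k) =
      (-1) ^ Suc k * of_nat (n choose Suc k) * g (Suc k) - (-1) ^ k * of_nat (n choose k) * g (Suc k)"
      by (simp add: algebra_simps)
  qed simp
  also have "g 0 + \<dots> = (\<Sum>k\<le>Suc n. (-1) ^ k * of_nat (n choose k) * g k) -
    (\<Sum>k\<le>n. (-1) ^ k * of_nat (n choose k) * g (Suc k))"
    by (subst sum.atMost_Suc_shift) simp
  finally show ?thesis by (simp add: binomial_eq_0)
qed

section \<open>Generating functions that count finite sets by size\<close>

definition size_gf :: "'a set set \<Rightarrow> real fps" where
  "size_gf F = Abs_fps (\<lambda>n. real (card {S \<in> F. card S = n}))"

text \<open>Since \<open>card\<close> sends infinite sets to 0, \<open>size_gf\<close> is a true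
  count only when the members and each level are finite; the family itself may be infinite.\<close>

definition levelwise_finite :: "'a set set \<Rightarrow> bool" where
  "levelwise_finite F \<longleftrightarrow> (\<forall>S\<in>F. finite S) \<and> (\<forall>n. finite {S \<in> F. card S = n})"

lemma levelwise_finite_subset:
  "levelwise_finite F \<Longrightarrow> G \<subseteq> F \<Longrightarrow> levelwise_finite G"
  unfolding levelwise_finite_def by (blast intro: rev_finite_subset)

lemma size_gf_diff:
  assumes "levelwise_finite F" "G \<subseteq> F"
  shows "size_gf (F - G) = size_gf F - size_gf G"
proof (rule fps_ext)
  fix n
  have fin: "finite {S \<in> F. card S = n}" using assms(1) by (simp add: levelwise_finite_def)
  have sub: "{S \<in> G. card S = n} \<subseteq> {S \<in> F. card S = n}" using assms(2) by blast
  have "{S \<in> F - G. card S = n} = {S \<in> F. card S = n} - {S \<in> G. card S = n}" by blast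
  thus "fps_nth (size_gf (F - G)) n = fps_nth (size_gf F - size_gf G) n"
    using card_Diff_subset[OF finite_subset[OF sub fin] sub] card_mono[OF fin sub]
    by (simp add: size_gf_def of_nat_diff)
qed

lemma size_gf_image:
  assumes "inj_on f (\<Union>F)" shows "size_gf ((`) f ` F) = size_gf F"
    and "levelwise_finite F \<Longrightarrow> levelwise_finite ((`) f ` F)"
proof -
  have card: "card (f ` S) = card S" if "S \<in> F" for S
    using that assms by (intro card_image) (meson Sup_upper inj_on_subset)
  have eq: "{S \<in> (`) f ` F. card S = n} = (`) f ` {S \<in> F. card S = n}" for n
    using card by auto
  have inj: "inj_on ((`) f) F"
    using assms by (rule inj_on_image)
  show "size_gf ((`) f ` F) = size_gf F"
  proof (rule fps_ext)
    fix n
    have "card ((`) f ` {S \<in> F. card S = n}) = card {S \<in> F. card S = n}"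
      using inj by (intro card_image) (auto simp: inj_on_def)
    thus "fps_nth (size_gf ((`) f ` F)) n = fps_nth (size_gf F) n" by (simp add: size_gf_def eq)
  qed
  show "levelwise_finite F \<Longrightarrow> levelwise_finite ((`) f ` F)"
    unfolding levelwise_finite_def eq by auto
qed

text \<open>Intersecting a union with \<open>\<Union>F\<close> and with \<open>\<Union>G\<close>
  recovers its two parts, so unions correspond to pairs. Their sizes add, which is the Cauchy
  product.\<close>

lemma size_gf_disjoint_unions:
  assumes F: "levelwise_finite F" and G: "levelwise_finite G" and disj: "\<Union>F \<inter> \<Union>G = {}"
  defines "H \<equiv> (\<lambda>(A, B). A \<union> B) ` (F \<times> G)"
  shows "size_gf H = size_gf F * size_gf G" "levelwise_finite H"
proof -
  have inj: "inj_on (\<lambda>(A, B). A \<union> B) (F \<times> G)"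
  proof (rule inj_onI, clarify)
    fix A B A' B' assume *: "A \<in> F" "B \<in> G" "A' \<in> F" "B' \<in> G" "A \<union> B = A' \<union> B'"
    have "A = (A \<union> B) \<inter> \<Union>F" "A' = (A' \<union> B') \<inter> \<Union>F"
         "B = (A \<union> B) \<inter> \<Union>G" "B' = (A' \<union> B') \<inter> \<Union>G"
      using *(1-4) disj by blast+
    thus "A = A' \<and> B = B'" using *(5) by metis
  qed
  have card: "card (A \<union> B) = card A + card B" if "A \<in> F" "B \<in> G" for A B
    using that assms by (intro card_Un_disjoint) (auto simp: levelwise_finite_def)
  have level: "{S \<in> H. card S = n} = (\<lambda>(A, B). A \<union> B) `
     (\<Union>k\<in>{..n}. {A \<in> F. card A = k} \<times> {B \<in> G. card B = n - k})" (is "_ = _ ` ?L n") for n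
    
    unfolding H_def
  proof (intro equalityI subsetI)
    fix S assume "S \<in> {S \<in> (\<lambda>(A, B). A \<union> B) ` (F \<times> G). card S = n}"
    then obtain A B where "A \<in> F" "B \<in> G" "S = A \<union> B" "card A + card B = n" using card by auto
    thus "S \<in> (\<lambda>(A, B). A \<union> B) ` ?L n" by (intro image_eqI[of _ _ "(A, B)"]) auto
  qed (use card in auto)
  have fin: "finite {A \<in> F. card A = k}" "finite {A \<in> G. card A = k}" for k
    using F G by (auto simp: levelwise_finite_def)
  show "levelwise_finite H"
    unfolding levelwise_finite_def level
    using F G fin by (auto simp: H_def levelwise_finite_def)
  show "size_gf H = size_gf F * size_gf G"
  proof (rule fps_ext)
    fix n
    have "card {S \<in> H. card S = n} = card (?L n)"
      unfolding level by (intro card_image inj_on_subset[OF inj]) auto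
    also have "\<dots> = (\<Sum>k\<le>n. card {A \<in> F. card A = k} * card {B \<in> G. card B = n - k})"
      using fin by (subst card_UN_disjoint) (auto simp: card_cartesian_product)
    finally show "fps_nth (size_gf H) n = fps_nth (size_gf F * size_gf G) n"
      by (simp add: size_gf_def fps_mult_nth atLeast0AtMost)
  qed
qed

lemma size_gf_disjoint_UNION:
  fixes F :: "nat \<Rightarrow> 'a set set"
  assumes "\<And>j. j < n \<Longrightarrow> levelwise_finite (F j)"
    and "\<And>j k. j < n \<Longrightarrow> k < n \<Longrightarrow> j \<noteq> k \<Longrightarrow> \<Union>(F j) \<inter> \<Union>(F k) = {}"
  shows "size_gf {\<Union>j<n. T j | T. \<forall>j<n. T j \<in> F j} = (\<Prod>j<n. size_gf (F j)) \<and>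
    levelwise_finite {\<Union>j<n. T j | T. \<forall>j<n. T j \<in> F j}"
  using assms
proof (induction n)
  case 0
  \<comment> \<open>The only union over no index is the empty set, which accounts for the constant
    series 1.\<close>
  have "{S. S = ({}::'a set) \<and> card S = n} = (if n = 0 then {{}} else {})" for n by auto
  thus ?case by (auto simp: size_gf_def levelwise_finite_def fps_eq_iff)
next
  case (Suc n)
  let ?U = "\<lambda>n. {\<Union>j<n. T j | T. \<forall>j<n. T j \<in> F j}"
  have IH: "size_gf (?U n) = (\<Prod>j<n. size_gf (F j))" "levelwise_finite (?U n)"
    using Suc by auto
  have disj: "\<Union>(?U n) \<inter> \<Union>(F n) = {}"
  proof (rule equals0I)
    fix x assume "x \<in> \<Union>(?U n) \<inter> \<Union>(F n)"
    hence "x \<in> \<Union>(?U n)" and n: "x \<in> \<Union>(F n)" by blast+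
    then obtain T where T: "\<forall>j<n. T j \<in> F j" "x \<in> (\<Union>j<n. T j)" by auto
    then obtain j where "j < n" "x \<in> \<Union>(F j)" by auto
    thus False using Suc.prems(2)[of j n] n by auto
  qed
  have eq: "?U (Suc n) = (\<lambda>(A, B). A \<union> B) ` (?U n \<times> F n)"
  proof (intro equalityI subsetI)
    fix S assume "S \<in> ?U (Suc n)"
    then obtain T where "S = (\<Union>j<Suc n. T j)" "\<forall>j<Suc n. T j \<in> F j" by blast
    thus "S \<in> (\<lambda>(A, B). A \<union> B) ` (?U n \<times> F n)"
      by (intro image_eqI[of _ _ "(\<Union>j<n. T j, T n)"]) (auto simp: lessThan_Suc)
  next
    fix S assume "S \<in> (\<lambda>(A, B). A \<union> B) ` (?U n \<times> F n)"
    then obtain T B where T: "S = (\<Union>j<n. T j) \<union> B" "\<forall>j<n. T j \<in> F j" "B \<in> F n" by auto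
    have "S = (\<Union>j<Suc n. (T(n := B)) j)" "\<forall>j<Suc n. (T(n := B)) j \<in> F j"
      using T by (auto simp: lessThan_Suc less_Suc_eq)
    thus "S \<in> ?U (Suc n)" by blast
  qed
  show ?case
    unfolding eq
    using size_gf_disjoint_unions[OF IH(2) Suc.prems(1)[of n] disj] IH(1) by simp
qed

text \<open>\<open>Q\<close> is the undivided cell and \<open>M i j\<close> carries it onto the
  \<open>j\<close>-th slab of a split in direction \<open>i\<close>. The counting rests on two facts
  besides disjointness: maps of different directions commute, and a map of direction
  \<open>l\<close> does not change which slab of direction \<open>i\<close> contains a point. The
  converse of \<open>M_independent\<close> follows from commutation.\<close>

locale subdivision =
  fixes Q :: "'a set" and M :: "nat \<Rightarrow> nat \<Rightarrow> 'a \<Rightarrow> 'a" and I :: "nat set" and p :: nat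
  assumes p_ge_2: "p \<ge> 2" and Q_nonempty: "Q \<noteq> {}" and finite_I: "finite I"
    and inj_M: "i \<in> I \<Longrightarrow> j < p \<Longrightarrow> inj (M i j)"
    and M_subset: "i \<in> I \<Longrightarrow> j < p \<Longrightarrow> M i j ` Q \<subseteq> Q"
    and M_disjoint: "i \<in> I \<Longrightarrow> j < p \<Longrightarrow> k < p \<Longrightarrow> j \<noteq> k \<Longrightarrow> M i j ` Q \<inter> M i k ` Q = {}"
    and M_commute: "i \<in> I \<Longrightarrow> l \<in> I \<Longrightarrow> i \<noteq> l \<Longrightarrow> M i j (M l k x) = M l k (M i j x)"
    and M_independent: "i \<in> I \<Longrightarrow> l \<in> I \<Longrightarrow> i \<noteq> l \<Longrightarrow> j < p \<Longrightarrow> k < p \<Longrightarrow> x \<in> Q \<Longrightarrow>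
      M l k x \<in> M i j ` Q \<Longrightarrow> x \<in> M i j ` Q"
begin

definition join :: "nat \<Rightarrow> (nat \<Rightarrow> 'a set set) \<Rightarrow> 'a set set" where
  "join i T = (\<Union>j<p. (`) (M i j) ` T j)"

text \<open>Built from the first split downwards: a split of \<open>Q\<close>, then an arbitrary
  decomposition of each slab. The same set of cells may arise from several first directions, hence
  the later inclusion and exclusion.\<close>

inductive_set D :: "'a set set set" where
  whole: "{Q} \<in> D"
| join: "i \<in> I \<Longrightarrow> (\<And>j. j < p \<Longrightarrow> T j \<in> D) \<Longrightarrow> join i T \<in> D"

text \<open>Detects from the cells alone, without a history of splits, whether a first split in
  direction \<open>i\<close> is possible.\<close>

definition aligned :: "nat \<Rightarrow> 'a set set \<Rightarrow> bool" where
  "aligned i S \<longleftrightarrow> (\<forall>R\<in>S. \<exists>j<p. R \<subseteq> M i j ` Q)"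

lemma D_members: "S \<in> D \<Longrightarrow> finite S \<and> S \<noteq> {} \<and> (\<forall>R\<in>S. R \<subseteq> Q \<and> R \<noteq> {})"
proof (induction rule: D.induct)
  case whole
  show ?case using Q_nonempty by simp
next
  case (join i T)
  show ?case
  proof (intro conjI ballI)
    show "finite (local.join i T)" unfolding join_def using join by auto
    show "local.join i T \<noteq> {}"
      unfolding join_def using join(2)[of 0] join(3)[of 0] p_ge_2 by (auto intro!: exI[of _ 0])
    fix R assume "R \<in> local.join i T"
    then obtain j R' where R: "j < p" "R' \<in> T j" "R = M i j ` R'" by (auto simp: join_def)
    have "R' \<subseteq> Q" "R' \<noteq> {}" using join(3)[OF R(1)] R(2) by auto
    thus "R \<subseteq> Q" "R \<noteq> {}" using M_subset[OF join(1) R(1)] R(3) by auto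
  qed
qed

lemma aligned_join_self:
  assumes "\<And>j. j < p \<Longrightarrow> T j \<in> D"
  shows "aligned i (join i T)"
  unfolding aligned_def join_def using D_members assms by blast

lemma other_index: "\<exists>k<p. k \<noteq> j"
  by (rule exI[of _ "if j = 0 then 1 else 0"]) (use p_ge_2 in auto)

lemma not_aligned_whole: "i \<in> I \<Longrightarrow> \<not> aligned i {Q}"
proof
  assume i: "i \<in> I" and "aligned i {Q}"
  then obtain j where j: "j < p" "Q \<subseteq> M i j ` Q" by (auto simp: aligned_def)
  obtain k where k: "k < p" "k \<noteq> j"
    using other_index by blast
  show False using M_disjoint[OF i j(1) k(1)] k(2) M_subset[OF i k(1)] j(2) Q_nonempty by blast
qed

text \<open>A split in direction \<open>l\<close> does not affect the position relative to the cuts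
  of direction \<open>i\<close>: one implication is \<open>M_independent\<close>, the other is
  commutation of the maps.\<close>

lemma aligned_join_other:
  assumes "i \<in> I" "l \<in> I" "i \<noteq> l" and T: "\<And>k. k < p \<Longrightarrow> T k \<in> D"
  shows "aligned i (join l T) \<longleftrightarrow> (\<forall>k<p. aligned i (T k))"
proof
  assume al: "aligned i (join l T)"
  show "\<forall>k<p. aligned i (T k)"
    unfolding aligned_def
  proof (intro allI impI ballI)
    fix k R assume k: "k < p" and R: "R \<in> T k"
    hence "M l k ` R \<in> join l T" by (auto simp: join_def)
    then obtain j where j: "j < p" "M l k ` R \<subseteq> M i j ` Q" using al by (auto simp: aligned_def)
    have "R \<subseteq> Q" using D_members[OF T[OF k]] R by blast
    hence "R \<subseteq> M i j ` Q"
      using M_independent[OF assms(1-3) j(1) k] j(2) by blast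
    thus "\<exists>j<p. R \<subseteq> M i j ` Q" using j(1) by blast
  qed
next
  assume al: "\<forall>k<p. aligned i (T k)"
  show "aligned i (join l T)"
    unfolding aligned_def
  proof
    fix R assume "R \<in> join l T"
    then obtain k R' where R: "k < p" "R' \<in> T k" "R = M l k ` R'" by (auto simp: join_def)
    then obtain j where j: "j < p" "R' \<subseteq> M i j ` Q"
      using al unfolding aligned_def by meson
    have "R \<subseteq> M l k ` M i j ` Q" using R j by blast
    also have "\<dots> = M i j ` M l k ` Q"
      using M_commute[OF assms(1-3)] by (simp add: image_image)
    also have "\<dots> \<subseteq> M i j ` Q" using M_subset[OF assms(2) R(1)] by blast
    finally show "\<exists>j<p. R \<subseteq> M i j ` Q" using j(1) by blast
  qed
qed

lemma join_swap:
  assumes "i \<in> I" "l \<in> I" "i \<noteq> l"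
  shows "join l (\<lambda>k. join i (T k)) = join i (\<lambda>j. join l (\<lambda>k. T k j))"
  unfolding join_def image_UN image_image M_commute[OF assms] by (rule SUP_commute)

text \<open>A decomposition compatible with the cuts in direction \<open>i\<close> starts, after reordering, with
  a split in direction \<open>i\<close>: a first split in another direction commutes with it.\<close>

lemma aligned_imp_join:
  assumes "S \<in> D" "i \<in> I" "aligned i S"
  shows "\<exists>T. (\<forall>j<p. T j \<in> D) \<and> S = join i T"
  using assms
proof (induction rule: D.induct)
  case whole
  thus ?case using not_aligned_whole by blast
next
  case (join l T)
  show ?case
  proof (cases "i = l")
    case True
    thus ?thesis using join by blast
  next
    case False
    have "\<forall>k<p. aligned i (T k)"
      using aligned_join_other[OF join(4,1) False, of T] join(2,5) by blast
    hence "\<forall>k<p. \<exists>U. (\<forall>j<p. U j \<in> D) \<and> T k = local.join i U" using join(3,4) by blast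
    then obtain U where U: "\<And>k j. k < p \<Longrightarrow> j < p \<Longrightarrow> U k j \<in> D"
        "\<And>k. k < p \<Longrightarrow> T k = local.join i (U k)"
      by metis
    have "local.join l T = local.join l (\<lambda>k. local.join i (U k))"
      unfolding join_def[of l] using U(2) by auto
    also have "\<dots> = local.join i (\<lambda>j. local.join l (\<lambda>k. U k j))"
      by (rule join_swap[OF join(4,1) False])
    finally show ?thesis
      using U(1) join(1) by (intro exI[of _ "\<lambda>j. local.join l (\<lambda>k. U k j)"]) (auto intro: D.join)
  qed
qed

section \<open>Inclusion and exclusion over the directions of a first split\<close>

lemma D_cases_aligned: "S \<in> D \<Longrightarrow> S = {Q} \<or> (\<exists>i\<in>I. aligned i S)"
  by (erule D.cases) (auto intro: aligned_join_self)

definition "aligned_all A = {S \<in> D. \<forall>i\<in>A. aligned i S}"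

text \<open>Undoing a first split in direction \<open>i\<close> leaves \<open>p\<close> slabs, each
  independently aligned in the directions of \<open>A\<close>. Iteration produces the grid, whence
  the exponent \<open>p ^ card A\<close>.\<close>

lemma aligned_all_insert:
  assumes "insert i A \<subseteq> I" "i \<notin> A"
  shows "aligned_all (insert i A) = {join i T | T. \<forall>j<p. T j \<in> aligned_all A}" (is "?L = ?R")
proof (intro equalityI subsetI)
  have other: "aligned l (join i T) \<longleftrightarrow> (\<forall>k<p. aligned l (T k))"
    if "l \<in> A" "\<And>k. k < p \<Longrightarrow> T k \<in> D" for l T
    using that assms by (intro aligned_join_other) auto
  {
    fix S assume S: "S \<in> ?L"
    then obtain T where T: "\<forall>j<p. T j \<in> D" "S = join i T"
      using aligned_imp_join[of S i] assms by (auto simp: aligned_all_def)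
    thus "S \<in> ?R" using S other[of _ T] by (auto simp: aligned_all_def)
  next
    fix S assume "S \<in> ?R"
    then obtain T where T: "\<forall>j<p. T j \<in> aligned_all A" "S = join i T" by blast
    thus "S \<in> ?L"
      using other[of _ T] assms by (auto simp: aligned_all_def intro: D.join aligned_join_self)
  }
qed

lemma inj_on_image_M: "i \<in> I \<Longrightarrow> j < p \<Longrightarrow> inj_on ((`) (M i j)) X"
  using inj_M[of i j] by (meson inj_image_eq_iff inj_onI)

lemma M_images_disjoint:
  assumes "i \<in> I" "j < p" "k < p" "j \<noteq> k" "F \<subseteq> D" "G \<subseteq> D"
  shows "\<Union>((`) ((`) (M i j)) ` F) \<inter> \<Union>((`) ((`) (M i k)) ` G) = {}"
proof -
  have False if "S \<in> F" "R \<in> S" "S' \<in> G" "R' \<in> S'" "M i j ` R = M i k ` R'" for S R S' R'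
  proof -
    have "R \<subseteq> Q" "R \<noteq> {}" "R' \<subseteq> Q"
      using D_members that assms(5,6) by blast+
    thus False using M_disjoint[OF assms(1-4)] that(5) by blast
  qed
  thus ?thesis by fastforce
qed

lemma size_gf_join:
  assumes "i \<in> I" "F \<subseteq> D" "levelwise_finite F"
  shows "size_gf {join i T | T. \<forall>j<p. T j \<in> F} = size_gf F ^ p"
proof -
  let ?F = "\<lambda>j. (`) ((`) (M i j)) ` F"
  have "{join i T | T. \<forall>j<p. T j \<in> F} = {\<Union>j<p. T j | T. \<forall>j<p. T j \<in> ?F j}"
  proof (intro equalityI subsetI)
    fix S assume "S \<in> {\<Union>j<p. T j | T. \<forall>j<p. T j \<in> ?F j}"
    then obtain T where T: "S = (\<Union>j<p. T j)" "\<forall>j<p. T j \<in> ?F j" by blast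
    have "\<forall>j. \<exists>V. j < p \<longrightarrow> V \<in> F \<and> T j = (`) (M i j) ` V" using T(2) by blast
    from choice[OF this] obtain U where U: "\<forall>j<p. U j \<in> F \<and> T j = (`) (M i j) ` U j" by blast
    hence "S = join i U" using T(1) by (simp add: join_def)
    thus "S \<in> {join i T | T. \<forall>j<p. T j \<in> F}" using U by blast
  next
    fix S assume "S \<in> {join i T | T. \<forall>j<p. T j \<in> F}"
    then obtain U where "S = (\<Union>j<p. (`) (M i j) ` U j)" "\<forall>j<p. U j \<in> F" 
      by (auto simp: join_def)
    thus "S \<in> {\<Union>j<p. T j | T. \<forall>j<p. T j \<in> ?F j}" by blast
  qed
  moreover have "levelwise_finite (?F j)" "size_gf (?F j) = size_gf F" if "j < p" for j
    using size_gf_image[OF inj_on_image_M[OF assms(1) that]] assms(3) by auto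
  moreover have "\<Union>(?F j) \<inter> \<Union>(?F k) = {}" if "j < p" "k < p" "j \<noteq> k" for j k
    using M_images_disjoint[OF assms(1) that assms(2,2)] .
  ultimately show ?thesis
    using size_gf_disjoint_UNION[of p ?F] by simp
qed

lemma card_join:
  assumes "i \<in> I" and T: "\<And>j. j < p \<Longrightarrow> T j \<in> D"
  shows "card (join i T) = (\<Sum>j<p. card (T j))"
proof -
  have "card (join i T) = (\<Sum>j<p. card ((`) (M i j) ` T j))"
    unfolding join_def
  proof (rule card_UN_disjoint)
    show "\<forall>j\<in>{..<p}. \<forall>k\<in>{..<p}. j \<noteq> k \<longrightarrow> (`) (M i j) ` T j \<inter> (`) (M i k) ` T k = {}"
    proof (intro ballI impI)
      fix j k assume "j \<in> {..<p}" "k \<in> {..<p}" "j \<noteq> k"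
      thus "(`) (M i j) ` T j \<inter> (`) (M i k) ` T k = {}"
        using M_images_disjoint[OF assms(1), of j k "{T j}" "{T k}"] T by simp
    qed
  qed (use D_members T in auto)
  also have "\<dots> = (\<Sum>j<p. card (T j))"
    using inj_on_image_M[OF assms(1)] by (intro sum.cong) (auto simp: card_image)
  finally show ?thesis .
qed

text \<open>Strong induction on the number of cells: a join has at least two nonempty slabs, so each
  slab has fewer cells than the whole, and only finitely many tuples of smaller decompositions
  exist.\<close>

lemma levelwise_finite_D: "levelwise_finite D"
  unfolding levelwise_finite_def
proof (intro conjI allI ballI)
  fix n
  show "finite {S \<in> D. card S = n}"
  proof (induction n rule: less_induct)
    case (less n)
    let ?X = "\<Union>k<n. {S \<in> D. card S = k}"
    \<comment> \<open>\<open>join\<close> reads \<open>T\<close> only below \<open>p\<close>, so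
      extensional functions suffice, and these form a finite set.\<close>
    have fin: "finite (({..<p} \<rightarrow>\<^sub>E ?X))" using less by (intro finite_PiE) auto
    have "{S \<in> D. card S = n} \<subseteq> {{Q}} \<union> (\<Union>i\<in>I. join i ` ({..<p} \<rightarrow>\<^sub>E ?X))"
    proof
      fix S assume "S \<in> {S \<in> D. card S = n}"
      hence S: "S \<in> D" "card S = n" by auto
      from S(1) show "S \<in> {{Q}} \<union> (\<Union>i\<in>I. join i ` ({..<p} \<rightarrow>\<^sub>E ?X))"
      proof cases
        case (join i T)
        have "card (T j) < n" if j: "j < p" for j
        proof -
          obtain k where k: "k < p" "k \<noteq> j"
            using other_index by blast
          have "card (T j) + card (T k) = (\<Sum>j\<in>{j, k}. card (T j))" using k by simp
          also have "\<dots> \<le> (\<Sum>j<p. card (T j))" using j k by (intro sum_mono2) auto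
          also have "\<dots> = n" using card_join[OF join(2,3)] S(2) join(1) by simp
          finally have "card (T j) + card (T k) \<le> n" .
          moreover have "card (T k) > 0" 
            using D_members[OF join(3)[OF k(1)]] by (simp add: card_gt_0_iff)
          ultimately show ?thesis by simp
        qed
        hence "restrict T {..<p} \<in> {..<p} \<rightarrow>\<^sub>E ?X" using join(3) by auto
        moreover have "S = local.join i (restrict T {..<p})" using join(1) by (simp add: join_def)
        ultimately show ?thesis using join(2) by blast
      qed auto
    qed
    moreover have "finite \<dots>" using fin finite_I by auto
    ultimately show ?case by (rule finite_subset)
  qed
qed (use D_members in auto)

lemma size_gf_aligned_all:
  assumes "A \<subseteq> I"
  shows "size_gf (aligned_all A) = size_gf D ^ (p ^ card A)"
proof -
  have "finite A" using assms finite_I finite_subset by blast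
  thus ?thesis using assms
  proof (induction A rule: finite_induct)
    case empty
    show ?case by (simp add: aligned_all_def)
  next
    case (insert i A)
    have sub: "aligned_all A \<subseteq> D" by (auto simp: aligned_all_def)
    have "size_gf (aligned_all (insert i A)) = size_gf (aligned_all A) ^ p"
      unfolding aligned_all_insert[OF insert.prems insert.hyps(2)]
      using insert.prems sub levelwise_finite_subset[OF levelwise_finite_D sub]
      by (intro size_gf_join) auto
    thus ?case using insert by (simp add: power_mult[symmetric] mult.commute)
  qed
qed

text \<open>Directions are excluded one at a time: not being aligned in \<open>i\<close> is a
  difference of families, and Pascal's rule merges the two sums. \<open>A\<close> is kept general
  because the subtracted family demands alignment in one more direction.\<close>

lemma size_gf_aligned_exactly:
  assumes "finite B" "A \<union> B \<subseteq> I" "A \<inter> B = {}"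
  shows "size_gf {S \<in> aligned_all A. \<forall>i\<in>B. \<not> aligned i S} =
    (\<Sum>k\<le>card B. (-1) ^ k * of_nat (card B choose k) * size_gf D ^ p ^ (card A + k))"
  using assms
proof (induction B arbitrary: A rule: finite_induct)
  case empty
  thus ?case using size_gf_aligned_all[of A] by simp
next
  case (insert i B)
  let ?V = "\<lambda>A B. {S \<in> aligned_all A. \<forall>i\<in>B. \<not> aligned i S}"
  have finA: "finite A" using insert.prems(1) finite_I by (meson finite_subset le_supE)
  have "?V A B \<subseteq> D" by (auto simp: aligned_all_def)
  hence fin: "levelwise_finite (?V A B)" by (rule levelwise_finite_subset[OF levelwise_finite_D])
  have "?V A (insert i B) = ?V A B - ?V (insert i A) B" by (auto simp: aligned_all_def)
  hence "size_gf (?V A (insert i B)) = size_gf (?V A B) - size_gf (?V (insert i A) B)"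
    using size_gf_diff[OF fin, of "?V (insert i A) B"] by (auto simp: aligned_all_def)
  also have "size_gf (?V A B) =
     (\<Sum>k\<le>card B. (-1) ^ k * of_nat (card B choose k) * size_gf D ^ p ^ (card A + k))"
    using insert by (intro insert.IH) auto
  also have "size_gf (?V (insert i A) B) =
     (\<Sum>k\<le>card B. (-1) ^ k * of_nat (card B choose k) * size_gf D ^ p ^ (card (insert i A) + k))"
    using insert by (intro insert.IH) auto
  also have "card (insert i A) = Suc (card A)" using insert.prems insert.hyps finA by simp
  finally show ?case
    using insert.hyps alternating_binomial_sum_Suc[of "card B" "\<lambda>k. size_gf D ^ p ^ (card A + k)"]
    by simp
qed

text \<open>With \<open>A\<close> empty and \<open>B\<close> all of \<open>I\<close>, only the
  undivided \<open>{Q}\<close> survives the exclusion, and it contributes X.\<close>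

theorem size_gf_functional_equation:
  "(\<Sum>k\<le>card I. (-1) ^ k * of_nat (card I choose k) * size_gf D ^ p ^ k) = fps_X"
proof -
  have "{S \<in> aligned_all {}. \<forall>i\<in>I. \<not> aligned i S} = {{Q}}"
    using D_cases_aligned not_aligned_whole D.whole by (auto simp: aligned_all_def)
  moreover have "{S. S = {Q} \<and> card S = n} = (if n = 1 then {{Q}} else {})" for n by auto
  hence "size_gf {{Q}} = fps_X" by (auto simp: size_gf_def fps_eq_iff)
  ultimately show ?thesis using size_gf_aligned_exactly[of I "{}"] finite_I by simp
qed

end

section \<open>Decompositions of the cube\<close>

definition shrink :: "nat \<Rightarrow> nat \<Rightarrow> nat \<Rightarrow> (nat \<Rightarrow> real) \<Rightarrow> nat \<Rightarrow> real" where
  "shrink p i j x = x(i := (real j + x i) / real p)"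

abbreviation cube :: "nat \<Rightarrow> (nat \<Rightarrow> real) set" where
  "cube d \<equiv> rectangle d (\<lambda>_. 0) (\<lambda>_. 1)"

lemma mem_rectangle_iff:
  "x \<in> rectangle d a b \<longleftrightarrow> (\<forall>l\<in>{1..d}. a l < x l \<and> x l < b l) \<and> x \<in> extensional {1..d}"
  by (auto simp: rectangle_def PiE_iff)

lemma shrink_rectangle:
  assumes "p > 0" "i \<in> {1..d}"
  shows "shrink p i j ` rectangle d a b = rectangle d (shrink p i j a) (shrink p i j b)"
proof (intro equalityI subsetI)
  fix y assume "y \<in> shrink p i j ` rectangle d a b"
  thus "y \<in> rectangle d (shrink p i j a) (shrink p i j b)"
    using assms by (auto simp: mem_rectangle_iff shrink_def extensional_def divide_strict_right_mono)
next
  fix y assume y: "y \<in> rectangle d (shrink p i j a) (shrink p i j b)"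
  let ?x = "y(i := real p * y i - real j)"
  have "?x \<in> rectangle d a b"
    unfolding mem_rectangle_iff
  proof (intro conjI ballI)
    fix l assume l: "l \<in> {1..d}"
    have "shrink p i j a l < y l \<and> y l < shrink p i j b l" using y l by (simp add: mem_rectangle_iff)
    thus "a l < ?x l" "?x l < b l"
      using assms(1) by (auto simp: shrink_def field_simps split: if_splits)
  qed (use y assms in \<open>auto simp: mem_rectangle_iff extensional_def\<close>)
  moreover have "y = shrink p i j ?x" using assms by (simp add: shrink_def)
  ultimately show "y \<in> shrink p i j ` rectangle d a b" by blast
qed

text \<open>Denominators are cleared, so that a slab is recognised by consecutive integers around
  \<open>p * x i\<close>; containment and disjointness then become linear.\<close>

lemma mem_shrink_cube_iff:
  assumes "p > 0" "i \<in> {1..d}"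
  shows "x \<in> shrink p i j ` cube d \<longleftrightarrow>
    (\<forall>l\<in>{1..d} - {i}. 0 < x l \<and> x l < 1) \<and> real j < real p * x i \<and> real p * x i < real j + 1 \<and>
    x \<in> extensional {1..d}"
proof -
  have "(\<forall>l\<in>{1..d}. shrink p i j (\<lambda>_. 0) l < x l \<and> x l < shrink p i j (\<lambda>_. 1) l) \<longleftrightarrow>
     (\<forall>l\<in>{1..d} - {i}. 0 < x l \<and> x l < 1) \<and> real j < real p * x i \<and> real p * x i < real j + 1"
    (is "?L \<longleftrightarrow> ?R")
  proof
    assume L: ?L
    have "0 < x l \<and> x l < 1" if "l \<in> {1..d} - {i}" for l
      using bspec[OF L, of l] that by (auto simp: shrink_def)
    moreover have "real j < real p * x i \<and> real p * x i < real j + 1"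
      using bspec[OF L assms(2)] assms(1) by (auto simp: shrink_def field_simps)
    ultimately show ?R by blast
  next
    assume R: ?R
    show ?L
    proof
      fix l assume "l \<in> {1..d}"
      thus "shrink p i j (\<lambda>_. 0) l < x l \<and> x l < shrink p i j (\<lambda>_. 1) l"
        using R assms(1) by (cases "l = i") (auto simp: shrink_def field_simps)
    qed
  qed
  thus ?thesis using assms by (simp add: shrink_rectangle mem_rectangle_iff)
qed

lemma subdivision_cube:
  assumes "p \<ge> 2"
  shows "subdivision (cube d) (shrink p) {1..d} p"
proof
  have p: "p > 0" using assms by simp
  \<comment> \<open>Points of the cube are extensional outside the coordinates, hence the
    \<open>restrict\<close>.\<close>
  have "restrict (\<lambda>_. 1 / 2) {1..d} \<in> cube d" by (simp add: mem_rectangle_iff)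
  thus "cube d \<noteq> {}" by blast
  fix i assume i: "i \<in> {1..d}"
  show "inj (shrink p i j)" for j
  proof (rule injI)
    fix x y assume eq: "shrink p i j x = shrink p i j y"
    show "x = y"
    proof
      fix l show "x l = y l"
        using fun_cong[OF eq, of l] p by (cases "l = i") (auto simp: shrink_def)
    qed
  qed
  show "shrink p i j ` cube d \<subseteq> cube d" if "j < p" for j
  proof
    fix x assume "x \<in> shrink p i j ` cube d"
    hence x: "\<forall>l\<in>{1..d} - {i}. 0 < x l \<and> x l < 1" "real j < real p * x i"
       "real p * x i < real j + 1" "x \<in> extensional {1..d}"
      unfolding mem_shrink_cube_iff[OF p i] by blast+
    have "0 < real p * x i" using x(2) of_nat_0_le_iff[of j] by linarith
    moreover have "real j + 1 \<le> real p" using that by simp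
    hence "real p * x i < real p * 1" using x(3) by linarith
    ultimately have "0 < x i \<and> x i < 1" using p by (simp add: zero_less_mult_iff)
    thus "x \<in> cube d" using x unfolding mem_rectangle_iff by blast
  qed
  show "shrink p i j ` cube d \<inter> shrink p i k ` cube d = {}" if "j \<noteq> k" for j k
  proof (rule equals0I)
    fix x assume "x \<in> shrink p i j ` cube d \<inter> shrink p i k ` cube d"
    hence "real j < real p * x i" "real p * x i < real j + 1" 
       "real k < real p * x i" "real p * x i < real k + 1"
      using mem_shrink_cube_iff[OF p i] by blast+
    hence "real j < real k + 1" "real k < real j + 1" by linarith+
    thus False using that by linarith
  qed
  fix l assume l: "l \<in> {1..d}" "i \<noteq> l"
  show "shrink p i j (shrink p l k x) = shrink p l k (shrink p i j x)" for j k x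
    using l by (auto simp: shrink_def fun_upd_twist)
  show "x \<in> shrink p i j ` cube d" if "x \<in> cube d" "shrink p l k x \<in> shrink p i j ` cube d" for j k x
    using that l unfolding mem_shrink_cube_iff[OF p i] mem_rectangle_iff by (auto simp: shrink_def)
qed (use assms in auto)

text \<open>Cut points are affine combinations of the end points, and \<open>shrink\<close> is
  affine in coordinate \<open>i\<close> and the identity in the others.\<close>

lemma cut_point_shrink:
  "p > 0 \<Longrightarrow> cut_point p (shrink p i j a) (shrink p i j b) l k =
     (if l = i then (real j + cut_point p a b i k) / real p else cut_point p a b l k)"
  by (auto simp: cut_point_def shrink_def field_simps)

lemma shrink_splitting:
  assumes "p > 0" "i \<in> {1..d}"
  shows "(`) (shrink p i j) ` splitting d p l a b =
    splitting d p l (shrink p i j a) (shrink p i j b)"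
proof -
  have "shrink p i j (c(l := cut_point p a b l k)) =
     (shrink p i j c)(l := cut_point p (shrink p i j a) (shrink p i j b) l k)" for c k
    unfolding cut_point_shrink[OF assms(1)] by (auto simp: shrink_def fun_eq_iff)
  thus ?thesis
    unfolding splitting_def image_image shrink_rectangle[OF assms] by simp
qed

lemma shrink_less:
  "p > 0 \<Longrightarrow> \<forall>l\<in>{1..d}. a l < b l \<Longrightarrow> \<forall>l\<in>{1..d}. shrink p i j a l < shrink p i j b l"
  by (auto simp: shrink_def divide_strict_right_mono)

locale cube_subdivision =
  fixes d p :: nat
  assumes p: "p \<ge> 2"
begin

sublocale subdivision "cube d" "shrink p" "{1..d}" p
  by (rule subdivision_cube[OF p])

lemma p_pos: "p > 0" using p by simp

lemma join_cube:
  assumes "i \<in> {1..d}"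
  shows "join i (\<lambda>_. {cube d}) = splitting d p i (\<lambda>_. 0) (\<lambda>_. 1)"
proof -
  \<comment> \<open>\<open>splitting\<close> numbers its slabs from 1, \<open>shrink\<close> from
    0.\<close>
  have Suc: "{1..p} = Suc ` {..<p}"
    by (simp add: lessThan_atLeast0 image_Suc_atLeastLessThan atLeastLessThanSuc_atLeastAtMost)
  have "join i (\<lambda>_. {cube d}) = (\<lambda>j. shrink p i j ` cube d) ` {..<p}"
    by (auto simp: join_def)
  also have "\<dots> = (\<lambda>j. rectangle d (shrink p i j (\<lambda>_. 0)) (shrink p i j (\<lambda>_. 1))) ` {..<p}"
    by (simp only: shrink_rectangle[OF p_pos assms])
  also have "\<dots> = splitting d p i (\<lambda>_. 0) (\<lambda>_. 1)"
    unfolding splitting_def Suc image_image by (simp add: shrink_def cut_point_def add.commute)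
  finally show ?thesis .
qed

section \<open>Agreement of the recursive and the stepwise description of decompositions\<close>

lemma D_rectangle:
  "S \<in> D \<Longrightarrow> R \<in> S \<Longrightarrow> \<exists>a b. R = rectangle d a b \<and> (\<forall>l\<in>{1..d}. a l < b l)"
proof (induction arbitrary: R rule: D.induct)
  case whole
  thus ?case by (intro exI[of _ "\<lambda>_. 0"] exI[of _ "\<lambda>_. 1"]) auto
next
  case (join i T)
  then obtain j R' where R: "j < p" "R' \<in> T j" "R = shrink p i j ` R'" by (auto simp: join_def)
  then obtain a b where "R' = rectangle d a b" "\<forall>l\<in>{1..d}. a l < b l" using join.IH by blast
  thus ?case
    using R(3) shrink_rectangle[OF p_pos join.hyps(1)] shrink_less[OF p_pos] by metis
qed

text \<open>A later split of one cell takes place inside the slab containing that cell. Descending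
  through the slabs ends at an undivided cell, whose split is a join of whole slabs.\<close>

lemma D_split:
  assumes "S \<in> D" "\<forall>l\<in>{1..d}. a l < b l" "rectangle d a b \<in> S" "i \<in> {1..d}"
  shows "S - {rectangle d a b} \<union> splitting d p i a b \<in> D \<and>
    card (S - {rectangle d a b} \<union> splitting d p i a b) = card S + (p - 1)"
  using assms(1-3)
proof (induction arbitrary: a b rule: D.induct)
  case whole
  have "{cube d} - {rectangle d a b} \<union> splitting d p i a b = join i (\<lambda>_. {cube d})"
    using whole splitting_well_defined[of d a b "\<lambda>_. 0" "\<lambda>_. 1" i p] assms(4) join_cube by auto
  moreover have "join i (\<lambda>_. {cube d}) \<in> D" using assms(4) D.whole by (intro D.join) auto
  moreover have "card (join i (\<lambda>_. {cube d})) = p"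
    using card_join[OF assms(4), of "\<lambda>_. {cube d}"] D.whole by simp
  ultimately show ?case using p_pos by simp
next
  case (join m T)
  let ?R = "rectangle d a b"
  obtain j R0 where R0: "j < p" "R0 \<in> T j" "?R = shrink p m j ` R0"
    using join.prems by (auto simp: join_def)
  obtain a0 b0 where ab: "R0 = rectangle d a0 b0" "\<forall>l\<in>{1..d}. a0 l < b0 l"
    using D_rectangle[OF join.hyps(2)[OF R0(1)] R0(2)] by blast
  \<comment> \<open>\<open>a0\<close> and \<open>b0\<close> bound the preimage of the cell in the
    unshrunk cube; only slab \<open>j\<close> is altered.\<close>
  define T' where "T' = T(j := T j - {R0} \<union> splitting d p i a0 b0)"
  have IH: "T' j \<in> D" "card (T' j) = card (T j) + (p - 1)"
    using join.IH[OF R0(1), of a0 b0] ab R0(2) by (auto simp: T'_def)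
  have T': "T' k \<in> D" if "k < p" for k
    using join.hyps(2)[OF that] IH(1) by (cases "k = j") (auto simp: T'_def)
  \<comment> \<open>The given end points and the shrunk ones may differ outside the coordinates, so
    the splittings are compared through the common rectangle.\<close>
  have "splitting d p i a b = splitting d p i (shrink p m j a0) (shrink p m j b0)"
    using join.prems(1) R0(3) ab shrink_rectangle[OF p_pos join.hyps(1)] assms(4)
    by (intro splitting_well_defined) auto
  hence split: "splitting d p i a b = (`) (shrink p m j) ` splitting d p i a0 b0"
    using shrink_splitting[OF p_pos join.hyps(1)] by simp
  have other: "(`) (shrink p m k) ` T k - {?R} = (`) (shrink p m k) ` T k" if "k < p" "k \<noteq> j" for k
    using M_images_disjoint[OF join.hyps(1) that(1) R0(1) that(2), of "{T k}" "{T j}"] 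
      join.hyps(2) that R0 by auto
  have at_j: "(`) (shrink p m j) ` T j - {?R} = (`) (shrink p m j) ` (T j - {R0})"
    using R0(3) image_set_diff[OF inj_on_image_M[OF join.hyps(1) R0(1), of UNIV]] by simp
  have dec: "(\<Union>k<p. U k) = U j \<union> (\<Union>k\<in>{..<p} - {j}. U k)" for U :: "nat \<Rightarrow> (nat \<Rightarrow> real) set set"
    using R0(1) by blast
  have "join m T - {?R} = ((`) (shrink p m j) ` T j - {?R}) \<union>
      (\<Union>k\<in>{..<p} - {j}. (`) (shrink p m k) ` T k - {?R})"
    unfolding join_def dec by blast
  also have "(\<Union>k\<in>{..<p} - {j}. (`) (shrink p m k) ` T k - {?R}) =
      (\<Union>k\<in>{..<p} - {j}. (`) (shrink p m k) ` T' k)"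
    using other by (intro SUP_cong refl) (simp add: T'_def)
  finally have "join m T - {?R} \<union> splitting d p i a b = 
      (`) (shrink p m j) ` (T j - {R0} \<union> splitting d p i a0 b0) \<union>
      (\<Union>k\<in>{..<p} - {j}. (`) (shrink p m k) ` T' k)"
    by (simp only: at_j split image_Un Un_ac)
  also have "\<dots> = join m T'" unfolding join_def dec by (simp add: T'_def)
  finally have "join m T - {?R} \<union> splitting d p i a b = join m T'" .
  moreover have "join m T' \<in> D" using join.hyps(1) T' by (rule D.join)
  moreover have "card (join m T') = card (join m T) + (p - 1)"
  proof -
    have "card (join m T') = (\<Sum>k<p. card (T' k))" using join.hyps(1) T' by (rule card_join)
    also have "\<dots> = card (T' j) + (\<Sum>k\<in>{..<p} - {j}. card (T' k))"
      using R0(1) by (subst sum.remove[of _ j]) auto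
    also have "(\<Sum>k\<in>{..<p} - {j}. card (T' k)) = (\<Sum>k\<in>{..<p} - {j}. card (T k))"
      by (intro sum.cong) (auto simp: T'_def)
    also have "card (T' j) + \<dots> = (\<Sum>k<p. card (T k)) + (p - 1)"
      using R0(1) IH(2) by (subst (2) sum.remove[of _ j]) auto
    also have "(\<Sum>k<p. card (T k)) = card (join m T)"
      using card_join[OF join.hyps(1,2)] by simp
    finally show ?thesis .
  qed
  ultimately show ?case by simp
qed

lemma reachable_imp_D: "reachable d p m S \<Longrightarrow> S \<in> D \<and> card S = 1 + m * (p - 1)"
proof (induction rule: reachable.induct)
  case start
  show ?case using D.whole by simp
next
  case (split m S a b i)
  thus ?case using D_split[of S a b i] by simp
qed

text \<open>The history of \<open>T\<close> is replayed inside one slab while the other cells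
  \<open>X\<close> stay put. The condition on \<open>X\<close> ensures that removing a cell of the
  slab removes nothing from \<open>X\<close>.\<close>

lemma reachable_graft:
  assumes "reachable d p n T" "i \<in> {1..d}" "j < p"
    and "reachable d p m (insert (shrink p i j ` cube d) X)"
    and X: "\<And>R. R \<subseteq> cube d \<Longrightarrow> R \<noteq> {} \<Longrightarrow> shrink p i j ` R \<notin> X"
  shows "reachable d p (m + n) ((`) (shrink p i j) ` T \<union> X)"
  using assms(1)
proof (induction rule: reachable.induct)
  case start
  show ?case using assms(4) by simp
next
  case (split n T a b l)
  let ?R = "rectangle d a b" and ?R' = "rectangle d (shrink p i j a) (shrink p i j b)"
  have R': "?R' = shrink p i j ` ?R" using shrink_rectangle[OF p_pos assms(2)] by simp
  have "?R \<subseteq> cube d \<and> ?R \<noteq> {}"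
    using D_members reachable_imp_D[OF split(1)] split(3) by blast
  hence "?R' \<notin> X" using X R' by simp
  moreover have "(`) (shrink p i j) ` T - {?R'} = (`) (shrink p i j) ` (T - {?R})"
    unfolding R' using image_set_diff[OF inj_on_image_M[OF assms(2,3), of UNIV], of T "{?R}"] by simp
  ultimately have "(`) (shrink p i j) ` (T - {?R} \<union> splitting d p l a b) \<union> X =
     ((`) (shrink p i j) ` T \<union> X) - {?R'} \<union> splitting d p l (shrink p i j a) (shrink p i j b)"
    using shrink_splitting[OF p_pos assms(2), of j l a b] by (auto simp: image_Un)
  moreover have "reachable d p (Suc (m + n)) \<dots>"
    using split shrink_less[OF p_pos split(2)] R' by (intro reachable.split) auto
  ultimately show ?case by simp
qed

lemma D_imp_reachable: "S \<in> D \<Longrightarrow> \<exists>m. reachable d p m S"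
proof (induction rule: D.induct)
  case whole
  show ?case using reachable.start by blast
next
  case (join i T)
  \<comment> \<open>Slabs with index below \<open>k\<close> already carry their decompositions, the
    others are still whole; one graft fills slab \<open>k\<close>.\<close>
  let ?T = "\<lambda>k j. if j < k then T j else {cube d}"
  have T: "?T k j \<in> D" if "j < p" for k j using join.hyps(2)[OF that] D.whole by simp
  have steps: "k \<le> p \<Longrightarrow> \<exists>m. reachable d p m (join i (?T k))" for k
  proof (induction k)
    case 0
    have "reachable d p (Suc 0) ({cube d} - {cube d} \<union> splitting d p i (\<lambda>_. 0) (\<lambda>_. 1))"
      using join.hyps(1) by (intro reachable.split reachable.start) auto
    thus ?case using join_cube[OF join.hyps(1)] by auto
  next
    case (Suc k)
    hence k: "k < p" by simp
    define X where "X = (\<Union>j\<in>{..<p} - {k}. (`) (shrink p i j) ` ?T k j)"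
    have dec: "join i T' = (`) (shrink p i k) ` T' k \<union> 
        (\<Union>j\<in>{..<p} - {k}. (`) (shrink p i j) ` T' j)" for T'
      unfolding join_def using k by blast
    have X': "X = (\<Union>j\<in>{..<p} - {k}. (`) (shrink p i j) ` ?T (Suc k) j)"
      unfolding X_def by (intro SUP_cong refl) auto
    obtain m n where mn: "reachable d p m (join i (?T k))" "reachable d p n (T k)"
      using Suc.IH join.IH[OF k] k by (meson less_imp_le)
    have "join i (?T k) = insert (shrink p i k ` cube d) X"
      unfolding dec X_def by simp
    moreover have "shrink p i k ` R \<notin> X" if R: "R \<subseteq> cube d" "R \<noteq> {}" for R
    proof
      assume "shrink p i k ` R \<in> X"
      then obtain j R' where j: "j < p" "j \<noteq> k" "R' \<in> ?T k j" "shrink p i k ` R = shrink p i j ` R'"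
        unfolding X_def by blast
      have "R' \<subseteq> cube d" using D_members[OF T[OF j(1)]] j(3) by blast
      thus False using M_disjoint[OF join.hyps(1) j(1) k j(2)] R j(4) by blast
    qed
    ultimately have "reachable d p (m + n) ((`) (shrink p i k) ` T k \<union> X)"
      using mn join.hyps(1) k by (intro reachable_graft) auto
    moreover have "join i (?T (Suc k)) = (`) (shrink p i k) ` T k \<union> X"
      unfolding dec X' by simp
    ultimately show ?case by metis
  qed
  have "\<exists>m. reachable d p m (join i (?T p))" by (rule steps) simp
  moreover have "join i (?T p) = join i T" by (simp add: join_def)
  ultimately show ?case by simp
qed

lemma decompositions_eq: "decompositions d p n = {S \<in> D. card S = n}"
proof -
  have "\<exists>m. card S = 1 + m * (p - 1) \<and> reachable d p m S" if S: "S \<in> D" for S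
    using D_imp_reachable[OF S] reachable_imp_D by blast
  thus ?thesis unfolding decompositions_def using reachable_imp_D by blast
qed

lemma size_gf_eq_C: "size_gf D = Abs_fps (\<lambda>n. real (C d p n))"
  by (simp add: size_gf_def C_def decompositions_eq)

end

theorem C_functional_equation:
  assumes "p \<ge> 2"
  shows "(\<Sum>k\<le>d. (-1) ^ k * of_nat (d choose k) * Abs_fps (\<lambda>n. real (C d p n)) ^ p ^ k) = fps_X"
proof -
  interpret cube_subdivision d p by unfold_locales (rule assms)
  show ?thesis using size_gf_functional_equation unfolding size_gf_eq_C by simp
qed

lemma C_0: "C d p 0 = 0"
  by (simp add: C_def decompositions_def)

section \<open>Lagrange inversion and positivity\<close>

text \<open>As \<open>Q\<close> has no constant term, \<open>Q ^ k\<close> starts at degree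
  \<open>k\<close> or later, so the composition may be cut off at \<open>k = m\<close> before
  multiplying.\<close>

lemma fps_nth_compose_mult:
  fixes G Q H :: "'a::idom fps"
  assumes "fps_nth Q 0 = 0"
  shows "fps_nth ((G oo Q) * H) m = (\<Sum>k\<le>m. fps_nth G k * fps_nth (Q ^ k * H) m)"
proof -
  have "fps_nth (G oo Q) j = (\<Sum>k\<le>m. fps_nth G k * fps_nth (Q ^ k) j)" if "j \<le> m" for j
    unfolding fps_compose_nth using that assms
    by (intro sum.mono_neutral_left) (auto simp: startsby_zero_power_prefix)
  hence "fps_nth ((G oo Q) * H) m =
     (\<Sum>j=0..m. (\<Sum>k\<le>m. fps_nth G k * fps_nth (Q ^ k) j) * fps_nth H (m - j))"
    unfolding fps_mult_nth by (intro sum.cong) auto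
  also have "\<dots> = (\<Sum>k\<le>m. \<Sum>j=0..m. fps_nth G k * (fps_nth (Q ^ k) j * fps_nth H (m - j)))"
    unfolding sum_distrib_right by (subst sum.swap) (simp add: mult.assoc)
  finally show ?thesis by (simp add: fps_mult_nth sum_distrib_left)
qed

text \<open>\<open>X\<^sup>k B\<^sup>n Q'\<close> has the same coefficient at \<open>n - 1\<close> as the
  Laurent series \<open>Q\<^sup>k Q' / Q\<^sup>n\<close> has at \<open>-1\<close>, which is the derivative of
  a Laurent series unless \<open>k + 1 = n\<close>.\<close>

theorem fps_lagrange_inversion:
  fixes F A :: "'a::field_char_0 fps"
  assumes "fps_nth A 0 \<noteq> 0" and F: "F oo (fps_X * A) = fps_X" and n: "n \<ge> 1"
  shows "of_nat n * fps_nth F n = fps_nth (inverse A ^ n) (n - 1)"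
proof -
  let ?Q = "fps_X * A" and ?B = "inverse A"
  have Q0: "fps_nth ?Q 0 = 0" by simp
  have AB: "A * ?B = 1" using assms(1) by (simp add: inverse_mult_eq_1')
  have Q': "fps_deriv ?Q = A + fps_X * fps_deriv A" by simp
  have residue: "fps_nth (?B ^ r * fps_deriv ?Q) (r - 1) = (if r = 1 then 1 else 0)" if "r \<ge> 1" for r
  proof -
    from that obtain q where r: "r = Suc q" by (cases r) auto
    have "?B ^ r * fps_deriv ?Q = ?B ^ q * (A * ?B) + fps_X * (?B ^ r * fps_deriv A)"
      unfolding Q' r by (simp add: algebra_simps)
    hence eq: "?B ^ r * fps_deriv ?Q = ?B ^ q + fps_X * (?B ^ r * fps_deriv A)" by (simp add: AB)
    show ?thesis
    proof (cases q)
      case 0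
      thus ?thesis unfolding eq by (simp add: r)
    next
      case (Suc l)
      \<comment> \<open>Here \<open>q = r - 1\<close> is positive. Computing the coefficient of this
        derivative at \<open>l = q - 1\<close> in two ways makes the two summands of the residue
        cancel, by characteristic 0.\<close>
      have "fps_deriv (?B ^ q) = - of_nat q * (?B ^ r * fps_deriv A)"
        unfolding fps_deriv_power' fps_inverse_deriv[OF assms(1)]
        by (simp add: Suc r power2_eq_square algebra_simps)
      hence "fps_nth (fps_deriv (?B ^ q)) l = - of_nat q * fps_nth (?B ^ r * fps_deriv A) l"
        by simp
      moreover have "fps_nth (fps_deriv (?B ^ q)) l = of_nat q * fps_nth (?B ^ q) q"
        by (simp only: fps_deriv_nth Suc Suc_eq_plus1)
      ultimately have "of_nat q * (fps_nth (?B ^ q) q + fps_nth (?B ^ r * fps_deriv A) l) = 0"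
        by (simp only: distrib_left) simp
      moreover have "(of_nat q :: 'a) \<noteq> 0" unfolding of_nat_eq_0_iff using Suc by simp
      ultimately have "fps_nth (?B ^ q) q + fps_nth (?B ^ r * fps_deriv A) l = 0"
        by (metis mult_eq_0_iff)
      thus ?thesis unfolding eq using Suc r by simp
    qed
  qed
  have "fps_deriv (F oo ?Q) = (fps_deriv F oo ?Q) * fps_deriv ?Q"
    by (rule fps_compose_deriv[OF Q0])
  hence *: "(fps_deriv F oo ?Q) * (fps_deriv ?Q * ?B ^ n) = ?B ^ n"
    by (simp add: F mult.assoc[symmetric])
  have "fps_nth (?B ^ n) (n - 1) =
      fps_nth ((fps_deriv F oo ?Q) * (fps_deriv ?Q * ?B ^ n)) (n - 1)"
    by (simp only: *)
  also have "\<dots> =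
      (\<Sum>k\<le>n - 1. fps_nth (fps_deriv F) k * fps_nth (?Q ^ k * (fps_deriv ?Q * ?B ^ n)) (n - 1))"
    by (rule fps_nth_compose_mult[OF Q0])
  \<comment> \<open>Only \<open>k = n - 1\<close> has a nonzero residue, and there the coefficient
    of \<open>fps_deriv F\<close> is \<open>n\<close> times that of \<open>F\<close> at
    \<open>n\<close>.\<close>
  also have "\<dots> = (\<Sum>k\<le>n - 1. if k = n - 1 then of_nat n * fps_nth F n else 0)"
  proof (rule sum.cong)
    fix k assume "k \<in> {..n - 1}"
    hence k: "k + (n - k) = n" "n - k \<ge> 1" "n - 1 - k = (n - k) - 1" using n by auto
    have "?Q ^ k * (fps_deriv ?Q * ?B ^ (k + (n - k))) =
        fps_X ^ k * ((A * ?B) ^ k * (?B ^ (n - k) * fps_deriv ?Q))"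
      unfolding power_add power_mult_distrib by (simp only: mult_ac)
    hence "?Q ^ k * (fps_deriv ?Q * ?B ^ n) = fps_X ^ k * (?B ^ (n - k) * fps_deriv ?Q)"
      using k(1) by (simp add: AB)
    hence "fps_nth (?Q ^ k * (fps_deriv ?Q * ?B ^ n)) (n - 1) =
        (if n - 1 < k then 0 else fps_nth (?B ^ (n - k) * fps_deriv ?Q) (n - 1 - k))"
      by (simp only: fps_X_power_mult_nth)
    also have "\<dots> = (if k = n - 1 then 1 else 0)"
      using residue[OF k(2)] k n by (auto simp del: fps_deriv_mult)
    finally show "fps_nth (fps_deriv F) k * fps_nth (?Q ^ k * (fps_deriv ?Q * ?B ^ n)) (n - 1) =
        (if k = n - 1 then of_nat n * fps_nth F n else 0)"
      using n by simp
  qed simp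
  finally show ?thesis by simp
qed

text \<open>\<open>F\<close> is a right inverse of \<open>Q\<close> under composition and
  \<open>fps_inv Q\<close> a left inverse, so associativity makes them equal.\<close>

lemma fps_compose_eq_X_commute:
  fixes F Q :: "'a::field fps"
  assumes "fps_nth Q 0 = 0" "fps_nth Q 1 \<noteq> 0" "fps_nth F 0 = 0" "Q oo F = fps_X"
  shows "F oo Q = fps_X"
proof -
  have "fps_inv Q oo Q = fps_X" using assms(1,2) by (rule fps_inv)
  have "F = (fps_inv Q oo Q) oo F" using fps_inv[OF assms(1,2)] assms(3) by simp
  also have "\<dots> = fps_inv Q oo (Q oo F)"
    using assms(1,3) by (simp add: fps_compose_assoc)
  finally have "F = fps_inv Q" by (simp add: assms(4))
  thus ?thesis using fps_inv[OF assms(1,2)] by simp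
qed

section \<open>The reduced polynomial and the positivity of its reciprocal\<close>

definition exponent :: "nat \<Rightarrow> nat \<Rightarrow> nat" where
  "exponent p k = (\<Sum>i<k. p ^ i)"

lemma exponent_Suc: "exponent p (Suc k) = 1 + p * exponent p k"
  unfolding exponent_def by (subst sum.lessThan_Suc_shift) (simp add: sum_distrib_left)

lemma exponent_eq: "1 + exponent p k * (p - 1) = p ^ k" if "p \<ge> 1"
proof (induction k)
  case (Suc k)
  have "1 + exponent p (Suc k) * (p - 1) = (1 + (p - 1)) + p * (exponent p k * (p - 1))"
    unfolding exponent_Suc by (simp add: algebra_simps)
  also have "\<dots> = p * (1 + exponent p k * (p - 1))"
    using that by (simp add: algebra_simps)
  finally show ?case unfolding Suc by simp
qed (simp add: exponent_def)

text \<open>The polynomial A with q(z) = z A(z^(p-1)). Its exponents are (p^k - 1) / (p - 1),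
  written as geometric sums to avoid division.\<close>

definition reduced_q :: "nat \<Rightarrow> nat \<Rightarrow> real poly" where
  "reduced_q d p = (\<Sum>k\<le>d. monom ((-1) ^ k * real (d choose k)) (exponent p k))"

lemma fps_of_poly_reduced_q:
  "fps_of_poly (reduced_q d p) = (\<Sum>k\<le>d. (-1) ^ k * of_nat (d choose k) * fps_X ^ exponent p k)"
proof -
  have "fps_of_poly (monom ((-1) ^ k * real (d choose k)) (exponent p k)) =
     (-1) ^ k * of_nat (d choose k) * fps_X ^ exponent p k" for k
    by (simp add: fps_of_poly_monom fps_const_mult[symmetric] fps_of_nat fps_const_power[symmetric]
        del: fps_const_mult fps_const_power)
  thus ?thesis by (simp add: reduced_q_def fps_of_poly_sum)
qed

text \<open>Pascal's rule combined with \<open>exponent_Suc\<close>: raising \<open>k\<close> by one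
  turns an exponent e into 1 + p e, that is, substitutes X^p and multiplies by X.\<close>

lemma fps_of_poly_reduced_q_Suc:
  assumes "p \<ge> 1"
  shows "fps_of_poly (reduced_q (Suc d) p) =
    fps_of_poly (reduced_q d p) - fps_X * (fps_of_poly (reduced_q d p) oo fps_X ^ p)"
proof -
  have p: "fps_nth (fps_X ^ p :: real fps) 0 = 0" using assms by simp
  have "fps_X * (fps_of_poly (reduced_q d p) oo fps_X ^ p) =
     (\<Sum>k\<le>d. (-1) ^ k * of_nat (d choose k) * fps_X ^ exponent p (Suc k))"
    unfolding fps_of_poly_reduced_q exponent_Suc
    by (simp add: fps_compose_sum_distrib fps_compose_mult_distrib[OF p] fps_compose_power[OF p, symmetric] fps_X_fps_compose_startby0[OF p]
      fps_compose_uminus sum_distrib_left power_mult mult_ac)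
  thus ?thesis
    using alternating_binomial_sum_Suc[of d "\<lambda>k. fps_X ^ exponent p k :: real fps"]
    by (simp add: fps_of_poly_reduced_q)
qed


lemma fps_of_poly_reduced_q_0: 
  assumes "p \<ge> 1" shows "fps_nth (fps_of_poly (reduced_q d p)) 0 = 1"
proof (induction d)
  case 0 
  show ?case by (simp add: fps_of_poly_reduced_q exponent_def)
next
  case (Suc d)
  show ?case unfolding fps_of_poly_reduced_q_Suc[OF assms] using Suc by simp
qed

text \<open>The coefficients of \<open>1 / (1 - h)\<close> increase, as they solve the renewal
  equation with \<open>h\<^sub>1 = 1\<close>; this makes up for the negative sign of
  \<open>h(X\<^sup>p)\<close>.\<close>

lemma fps_renewal:
  fixes h :: "real fps"
  assumes nonneg: "\<And>n. fps_nth h n \<ge> 0" and h0: "fps_nth h 0 = 0" and h1: "fps_nth h 1 = 1"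
    and p: "p \<ge> 1"
  shows "fps_nth (inverse (1 - h)) n \<ge> 1"
    and "fps_nth ((1 - (h oo fps_X ^ p)) * inverse (1 - h)) n \<ge> 0"
proof -
  let ?c = "inverse (1 - h)"
  have eq: "(1 - h) * ?c = 1" using h0 by (intro inverse_mult_eq_1') simp
  hence ren: "?c = 1 + h * ?c" by (simp add: algebra_simps)
  have c0: "fps_nth ?c 0 = 1" using h0 by simp
  have step: "fps_nth ?c n \<le> fps_nth ?c (Suc n) \<and> fps_nth ?c n \<ge> 1" for n
  proof (induction n rule: less_induct)
    case (less n)
    have ge1: "fps_nth ?c k \<ge> 1" if "k \<le> n" for k
    proof (cases k)
      case (Suc j)
      thus ?thesis using less[of j] that by simp
    qed (simp add: h0)
    \<comment> \<open>The term \<open>i = 1\<close> of the renewal sum alone is the previous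
      coefficient; the other terms are nonnegative.\<close>
    have "fps_nth ?c n = fps_nth h 1 * fps_nth ?c (Suc n - 1)" using h1 by simp
    also have "\<dots> = (\<Sum>i\<in>{1}. fps_nth h i * fps_nth ?c (Suc n - i))" by simp
    also have "\<dots> \<le> (\<Sum>i=0..Suc n. fps_nth h i * fps_nth ?c (Suc n - i))"
    proof (rule sum_mono2)
      fix i assume "i \<in> {0..Suc n} - {1}"
      show "0 \<le> fps_nth h i * fps_nth ?c (Suc n - i)"
      proof (cases "i = 0")
        case False
        hence "fps_nth ?c (Suc n - i) \<ge> 1" by (intro ge1) simp
        thus ?thesis using nonneg[of i] by simp
      qed (simp add: h0)
    qed auto
    also have "\<dots> = fps_nth ?c (Suc n)"
      by (subst (2) ren) (simp add: fps_mult_nth)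
    finally show ?case using ge1 by blast
  qed
  show "fps_nth ?c n \<ge> 1" using step by blast
  have mono: "fps_nth ?c i \<le> fps_nth ?c j" if "i \<le> j" for i j
    using lift_Suc_mono_le[of "fps_nth ?c"] step that by blast
  have "fps_nth ((h oo fps_X ^ p) * ?c) n =
      (\<Sum>i=0..n. (if p dvd i then fps_nth h (i div p) else 0) * fps_nth ?c (n - i))"
    using p by (simp add: fps_mult_nth fps_nth_compose_X_power)
  also have "\<dots> = (\<Sum>i\<in>(\<lambda>j. p * j) ` {j. p * j \<le> n}. fps_nth h (i div p) * fps_nth ?c (n - i))"
    by (intro sum.mono_neutral_cong_right) (auto elim!: dvdE)
  also have "\<dots> = (\<Sum>j | p * j \<le> n. fps_nth h j * fps_nth ?c (n - p * j))"
    using p by (subst sum.reindex) (auto simp: inj_on_def)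
  \<comment> \<open>Here \<open>n - p * j \<le> n - j\<close>, and the coefficients of
    \<open>?c\<close> increase.\<close>
  also have "\<dots> \<le> (\<Sum>j | p * j \<le> n. fps_nth h j * fps_nth ?c (n - j))"
    using p nonneg by (intro sum_mono mult_left_mono mono diff_le_mono2) auto
  also have "\<dots> \<le> (\<Sum>j=0..n. fps_nth h j * fps_nth ?c (n - j))"
  proof (rule sum_mono2)
    show "{j. p * j \<le> n} \<subseteq> {0..n}" 
    proof safe
      fix j assume "p * j \<le> n"
      moreover have "1 * j \<le> p * j" using p by (intro mult_right_mono) auto
      ultimately have "j \<le> n" by linarith
      thus "j \<in> {0..n}" by simp
    qed
    fix j
    show "0 \<le> fps_nth h j * fps_nth ?c (n - j)"
      using nonneg step[of "n - j"] by (intro mult_nonneg_nonneg) auto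
  qed simp
  also have "\<dots> = fps_nth (h * ?c) n" by (simp add: fps_mult_nth)
  also have "h * ?c = ?c - 1" by (subst (2) ren) simp
  finally have "fps_nth ((h oo fps_X ^ p) * ?c) n \<le> fps_nth (?c - 1) n" .
  moreover have "(1 - (h oo fps_X ^ p)) * ?c = ?c - (h oo fps_X ^ p) * ?c"
    by (simp add: algebra_simps)
  ultimately show "fps_nth ((1 - (h oo fps_X ^ p)) * ?c) n \<ge> 0"
    by (cases "n = 0") auto
qed

lemma fps_mult_nonneg:
  fixes f g :: "real fps"
  assumes "\<And>n. fps_nth f n \<ge> 0" "\<And>n. fps_nth g n \<ge> 0"
  shows "fps_nth (f * g) n \<ge> 0"
  unfolding fps_mult_nth using assms by (intro sum_nonneg) auto

text \<open>One has \<open>f (Suc d) = f d * (1 - h)\<close> with h = X f_d(X^p) / f_d. The second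
  conjunct says that h is nonnegative and is therefore carried through the induction;
  \<open>fps_renewal\<close> renews it. The third conjunct later makes the maximum of 1/A on the
  circle strict.\<close>

lemma inverse_reduced_q_nonneg_aux:
  assumes "p \<ge> 1"
  defines "f \<equiv> \<lambda>d. fps_of_poly (reduced_q d p)"
  shows "(\<forall>n. fps_nth (inverse (f d)) n \<ge> 0) \<and> (\<forall>n. fps_nth ((f d oo fps_X ^ p) * inverse (f d)) n \<ge> 0)
    \<and> (d \<ge> 1 \<longrightarrow> fps_nth (inverse (f d)) 1 \<ge> 1)"
proof (induction d)
  case 0
  thus ?case using assms by (simp add: fps_of_poly_reduced_q exponent_def)
next
  case (Suc d)
  define r where "r = (f d oo fps_X ^ p) * inverse (f d)"
  define h where "h = fps_X * r"
  have f0: "fps_nth (f n) 0 = 1" for n using fps_of_poly_reduced_q_0[OF assms(1)] by (simp add: f_def)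
  have Xp: "fps_nth (fps_X ^ p :: real fps) 0 = 0" using assms(1) by simp
  have r0: "fps_nth r 0 = 1" by (simp add: r_def f0)
  have h: "fps_nth h 0 = 0" "fps_nth h 1 = 1" "fps_nth h n \<ge> 0" for n
    using Suc r0 by (auto simp: h_def r_def)
  have inv: "f d * inverse (f d) = 1" using f0[of d] by (intro inverse_mult_eq_1') simp
  have "f (Suc d) = f d - fps_X * (f d oo fps_X ^ p)"
    unfolding f_def by (rule fps_of_poly_reduced_q_Suc[OF assms(1)])
  also have "\<dots> = f d - fps_X * (f d oo fps_X ^ p) * (f d * inverse (f d))"
    unfolding inv by simp
  also have "\<dots> = f d * (1 - h)"
    by (simp add: h_def r_def algebra_simps)
  finally have f: "f (Suc d) = f d * (1 - h)" .
  have finv: "inverse (f (Suc d)) = inverse (f d) * inverse (1 - h)"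
    unfolding f by (rule fps_inverse_mult)
  have "f (Suc d) oo fps_X ^ p = (f d oo fps_X ^ p) * (1 - (h oo fps_X ^ p))"
    unfolding f by (simp add: fps_compose_mult_distrib[OF Xp] fps_compose_sub_distrib)
  hence rSuc: "(f (Suc d) oo fps_X ^ p) * inverse (f (Suc d)) =
      r * ((1 - (h oo fps_X ^ p)) * inverse (1 - h))"
    unfolding finv r_def by (simp only: mult_ac)
  note ren = fps_renewal[OF h(3,1,2) assms(1)]
  have ren0: "fps_nth (inverse (1 - h)) n \<ge> 0" for n using ren(1)[of n] by linarith
  have "fps_nth (inverse (f (Suc d))) 1 = fps_nth (inverse (f d)) 1 + fps_nth (inverse (1 - h)) 1"
    unfolding finv using f0[of d] h(1) by (simp add: fps_mult_nth)
  also have "\<dots> \<ge> 1" using ren(1)[of 1] Suc by (simp add: add_increasing)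
  finally have "fps_nth (inverse (f (Suc d))) 1 \<ge> 1" .
  moreover have "fps_nth (inverse (f (Suc d))) n \<ge> 0" for n
    unfolding finv using Suc ren0 by (intro fps_mult_nonneg) blast+
  moreover have "fps_nth ((f (Suc d) oo fps_X ^ p) * inverse (f (Suc d))) n \<ge> 0" for n
  proof -
    have "fps_nth r k \<ge> 0" for k using Suc unfolding r_def by blast
    thus ?thesis unfolding rSuc by (rule fps_mult_nonneg) (rule ren(2))
  qed
  ultimately show ?case by blast
qed

lemma inverse_reduced_q_nonneg: "p \<ge> 1 \<Longrightarrow> fps_nth (inverse (fps_of_poly (reduced_q d p))) n \<ge> 0"
  and inverse_reduced_q_1: "p \<ge> 1 \<Longrightarrow> d \<ge> 1 \<Longrightarrow> fps_nth (inverse (fps_of_poly (reduced_q d p))) 1 \<ge> 1"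
  using inverse_reduced_q_nonneg_aux[of p d] by auto

text \<open>Lagrange inversion is applied to A(X^(p-1)). Powers of its reciprocal are series in
  X^(p-1), so the coefficient at n - 1 = m (p - 1) is the one at m before the substitution.\<close>

lemma fps_coeff_eq_if_functional_equation:
  fixes F :: "real fps"
  assumes p: "p \<ge> 2" and F0: "fps_nth F 0 = 0"
    and F: "(\<Sum>k\<le>d. (-1) ^ k * of_nat (d choose k) * F ^ p ^ k) = fps_X"
    and n: "n = 1 + m * (p - 1)"
  shows "real n * fps_nth F n = fps_nth (inverse (fps_of_poly (reduced_q d p)) ^ n) m"
proof -
  define r where "r = p - 1"
  have r: "r > 0" using p by (simp add: r_def)
  have X: "fps_nth (fps_X ^ r :: real fps) 0 = 0" using r by simp
  define A where "A = fps_of_poly (reduced_q d p) oo fps_X ^ r"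
  have A0: "fps_nth A 0 = 1" using fps_of_poly_reduced_q_0[of p d] p by (simp add: A_def)
  have "fps_X * A = (\<Sum>k\<le>d. (-1) ^ k * of_nat (d choose k) * fps_X ^ p ^ k)"
  proof -
    have pow: "(fps_X :: real fps) ^ p ^ k = fps_X * (fps_X ^ r) ^ exponent p k" for k
    proof -
      have "p ^ k = Suc (r * exponent p k)"
        using exponent_eq[of p k] p by (simp add: r_def mult.commute)
      thus ?thesis by (simp only: power_Suc power_mult)
    qed
    show ?thesis unfolding A_def fps_of_poly_reduced_q pow
      by (simp add: fps_compose_sum_distrib fps_compose_mult_distrib[OF X] fps_compose_power[OF X, symmetric] fps_X_fps_compose_startby0[OF X]
        fps_compose_uminus sum_distrib_left mult_ac)
  qed
  moreover have "(\<Sum>k\<le>d. (-1) ^ k * of_nat (d choose k) * fps_X ^ p ^ k) oo F = (\<Sum>k\<le>d. (-1) ^ k * of_nat (d choose k) * F ^ p ^ k)"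
    by (simp add: fps_compose_sum_distrib fps_compose_mult_distrib[OF F0] fps_compose_power[OF F0, symmetric] fps_X_fps_compose_startby0[OF F0]
        fps_compose_uminus F0)
  ultimately have "(fps_X * A) oo F = fps_X" by (simp only: F)
  moreover have "fps_nth (fps_X * A) 0 = 0" "fps_nth (fps_X * A) 1 \<noteq> 0" using A0 by simp_all
  ultimately have "F oo (fps_X * A) = fps_X" 
    using fps_compose_eq_X_commute[of "fps_X * A" F] F0 by blast
  moreover have "fps_nth A 0 \<noteq> 0" "n \<ge> 1" using A0 by (simp_all add: n)
  ultimately have "real n * fps_nth F n = fps_nth (inverse A ^ n) (n - 1)"
    using fps_lagrange_inversion[of A F n] by blast
  also have "inverse A ^ n = inverse (fps_of_poly (reduced_q d p)) ^ n oo fps_X ^ r"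
    unfolding A_def using fps_of_poly_reduced_q_0[of p d] p
    by (simp add: fps_inverse_compose[OF X] fps_compose_power[OF X, symmetric] fps_X_fps_compose_startby0[OF X])
  also have "n - 1 = m * r" by (simp add: n r_def)
  also have "fps_nth (inverse (fps_of_poly (reduced_q d p)) ^ n oo fps_X ^ r) (m * r) =
      fps_nth (inverse (fps_of_poly (reduced_q d p)) ^ n) m"
    using r by (simp add: fps_nth_compose_X_power)
  finally show ?thesis .
qed

section \<open>Laplace's method on a circle\<close>

lemma gaussian_integral:
  fixes c :: real assumes "c > 0"
  shows "has_bochner_integral lborel (\<lambda>x. exp (- (c * x\<^sup>2))) (sqrt (pi / c))"
proof -
  \<comment> \<open>A normal density of variance 1 / (2 c) has the exponent - c x^2.\<close>
  define \<sigma> where "\<sigma> = 1 / sqrt (2 * c)"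
  have \<sigma>: "\<sigma> > 0" "\<sigma>\<^sup>2 = 1 / (2 * c)" using assms by (auto simp: \<sigma>_def power_divide)
  have "sqrt (2 * pi * \<sigma>\<^sup>2) = sqrt (pi / c)" by (simp add: \<sigma>(2))
  moreover have "sqrt (pi / c) > 0" using assms by simp
  ultimately have "(\<lambda>x. sqrt (pi / c) * normal_density 0 \<sigma> x) = (\<lambda>x. exp (- (c * x\<^sup>2)))"
    using assms by (simp add: normal_density_def \<sigma>(2) fun_eq_iff field_simps)
  moreover have "has_bochner_integral lborel (\<lambda>x. sqrt (pi / c) * normal_density 0 \<sigma> x) (sqrt (pi / c) * 1)"
    using \<sigma>(1) by (intro has_bochner_integral_mult_right) (auto simp: has_bochner_integral_iff)
  ultimately show ?thesis by simp
qed

text \<open>In the closed unit disc, \<open>n\<close>-th powers of two numbers differ by at most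
  \<open>n\<close> times the distance of the numbers. Comparing \<open>z n\<close> with 1 - x / n in
  this way avoids complex logarithms.\<close>

lemma power_tendsto_exp:
  fixes z :: "nat \<Rightarrow> complex" and x :: real
  assumes norm: "eventually (\<lambda>n. norm (z n) \<le> 1) sequentially"
    and lim: "(\<lambda>n. of_nat n * (z n - 1)) \<longlonglongrightarrow> - of_real x" and x: "x \<ge> 0"
  shows "(\<lambda>n. z n ^ n) \<longlonglongrightarrow> of_real (exp (- x))"
proof -
  define w where "w n = complex_of_real (1 + (- x) / real n)" for n
  have "(\<lambda>n. of_nat n * (z n - 1) + of_real x) \<longlonglongrightarrow> - of_real x + of_real x"
    by (intro tendsto_intros lim)
  hence "(\<lambda>n. norm (of_nat n * (z n - 1) + of_real x)) \<longlonglongrightarrow> 0"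
    using tendsto_norm_zero by simp
  moreover have "eventually (\<lambda>n. norm (z n ^ n - w n ^ n) \<le>
      norm (of_nat n * (z n - 1) + of_real x)) sequentially"
    using norm eventually_gt_at_top[of 0] eventually_ge_at_top[of "nat \<lceil>x\<rceil>"]
  proof eventually_elim
    case (elim n)
    have "x \<le> real n" using elim(3) by linarith
    hence "norm (w n) \<le> 1" unfolding w_def norm_of_real using x elim(2) by (simp add: field_simps abs_if)
    hence "norm (z n ^ n - w n ^ n) \<le> real n * norm (z n - w n)"
      using elim(1) by (intro norm_power_diff)
    also have "\<dots> = norm (of_nat n * (z n - w n))" by (simp add: norm_mult)
    also have "of_nat n * (z n - w n) = of_nat n * (z n - 1) + of_real x"
      using elim(2) by (simp add: w_def field_simps)
    finally show ?case .
  qed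
  ultimately have "(\<lambda>n. z n ^ n - w n ^ n) \<longlonglongrightarrow> 0"
    by (rule Lim_null_comparison[rotated])
  moreover have "(\<lambda>n. w n ^ n) \<longlonglongrightarrow> of_real (exp (- x))"
    unfolding w_def of_real_power[symmetric]
    by (intro tendsto_of_real tendsto_exp_limit_sequentially)
  ultimately show ?thesis using tendsto_add by fastforce
qed

text \<open>After the substitution \<theta> = u / sqrt n the integrands converge pointwise to exp(-
  a u^2) and are dominated by K exp(- c u^2), because 1 - c \<theta>^2 \<le> exp(- c \<theta>^2).
  The same bound forces a \<ge> c.\<close>

lemma laplace_circle:
  fixes \<psi> g :: "real \<Rightarrow> complex" and a c :: real
  assumes cont: "continuous_on {-pi..pi} \<psi>" "continuous_on {-pi..pi} g"
    and bound: "\<And>\<theta>. \<theta> \<in> {-pi..pi} \<Longrightarrow> norm (\<psi> \<theta>) \<le> 1 - c * \<theta>\<^sup>2" and c: "c > 0"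
    and \<psi>0: "\<psi> 0 = 1" and g0: "g 0 = 1"
    and lim: "((\<lambda>\<theta>. (\<psi> \<theta> - 1) / of_real (\<theta>\<^sup>2)) \<longlongrightarrow> - of_real a) (at 0)"
  shows "a > 0"
    and "(\<lambda>n. of_real (sqrt (real n)) * integral {-pi..pi} (\<lambda>\<theta>. g \<theta> * \<psi> \<theta> ^ n)) \<longlonglongrightarrow>
      of_real (sqrt (pi / a))"
proof -
  let ?I = "{-pi..pi}"
  have nhd: "eventually (\<lambda>\<theta>. \<theta> \<in> {-pi<..<pi}) (nhds (0::real))"
    by (intro eventually_nhds_in_open) auto
  have "- a \<le> - c"
  proof (rule tendsto_upperbound)
    show "((\<lambda>\<theta>. Re ((\<psi> \<theta> - 1) / of_real (\<theta>\<^sup>2))) \<longlongrightarrow> - a) (at 0)"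
      using tendsto_Re[OF lim] by simp
    have "eventually (\<lambda>\<theta>. \<theta> \<in> {-pi<..<pi} - {0}) (at (0::real))"
      using nhd by (simp add: eventually_at_filter eventually_mono)
    thus "eventually (\<lambda>\<theta>. Re ((\<psi> \<theta> - 1) / of_real (\<theta>\<^sup>2)) \<le> - c) (at 0)"
    proof eventually_elim
      case (elim \<theta>)
      have "Re (\<psi> \<theta>) \<le> 1 - c * \<theta>\<^sup>2"
        using bound[of \<theta>] complex_Re_le_cmod[of "\<psi> \<theta>"] elim by auto
      thus ?case using elim by (simp add: Re_divide_of_real field_simps)
    qed
  qed simp
  thus a: "a > 0" using c by simp
  have "bounded (g ` ?I)"
    using compact_imp_bounded[OF compact_continuous_image[OF cont(2) compact_Icc]] .
  then obtain K where K: "\<And>\<theta>. \<theta> \<in> ?I \<Longrightarrow> norm (g \<theta>) \<le> K"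
    unfolding bounded_iff by blast
  have "K \<ge> 0" using K[of 0] g0 by simp
  define F where "F n \<theta> = indicator ?I \<theta> *\<^sub>R (g \<theta> * \<psi> \<theta> ^ n)" for n \<theta>
  have meas: "F n \<in> borel_measurable borel" for n
    unfolding F_def by (intro borel_measurable_continuous_on_indicator continuous_intros cont) auto
  have int: "integral ?I (\<lambda>\<theta>. g \<theta> * \<psi> \<theta> ^ n) = (\<integral>\<theta>. F n \<theta> \<partial>lborel)" for n
  proof -
    have "set_integrable lborel ?I (\<lambda>\<theta>. g \<theta> * \<psi> \<theta> ^ n)"
      by (intro borel_integrable_atLeastAtMost' continuous_intros cont)
    from set_borel_integral_eq_integral(2)[OF this] show ?thesis
      by (simp add: F_def set_lebesgue_integral_def)
  qed
  \<comment> \<open>For n = 0 the quotient u / sqrt 0 is 0, and \<open>F\<close> would give the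
    constant 1, which has no integrable bound; the value 0 does not affect the limit.\<close>
  define G where "G n u = (if n = 0 then 0 else F n (u / sqrt (real n)))" for n u
  have "(\<lambda>n. \<integral>u. G n u \<partial>lborel) \<longlonglongrightarrow> (\<integral>u. complex_of_real (exp (- (a * u\<^sup>2))) \<partial>lborel)"
  proof (rule integral_dominated_convergence)
    show "(\<lambda>u. complex_of_real (exp (- (a * u\<^sup>2)))) \<in> borel_measurable lborel" by simp
    show "G n \<in> borel_measurable lborel" for n
      unfolding G_def using meas[of n] by (cases "n = 0") simp_all
    show "integrable lborel (\<lambda>u. K * exp (- (c * u\<^sup>2)))"
      using gaussian_integral[OF c] by (auto simp: has_bochner_integral_iff)
    show "AE u in lborel. norm (G n u) \<le> K * exp (- (c * u\<^sup>2))" for n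
    proof (rule AE_I2)
      fix u :: real
      show "norm (G n u) \<le> K * exp (- (c * u\<^sup>2))"
      proof (cases "n > 0 \<and> u / sqrt (real n) \<in> ?I")
        case True
        define \<theta> where "\<theta> = u / sqrt (real n)"
        have \<theta>: "\<theta> \<in> ?I" "real n * \<theta>\<^sup>2 = u\<^sup>2" using True by (auto simp: \<theta>_def power_divide)
        have "norm (\<psi> \<theta>) \<le> exp (- (c * \<theta>\<^sup>2))"
          using bound[OF \<theta>(1)] exp_ge_add_one_self[of "- (c * \<theta>\<^sup>2)"] by linarith
        hence "norm (\<psi> \<theta>) ^ n \<le> exp (- (c * \<theta>\<^sup>2)) ^ n" by (intro power_mono) auto
        also have "\<dots> = exp (- (c * (real n * \<theta>\<^sup>2)))"
          by (simp add: exp_of_nat_mult[symmetric] algebra_simps)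
        finally have "norm (\<psi> \<theta> ^ n) \<le> exp (- (c * u\<^sup>2))" by (simp add: \<theta>(2) norm_power)
        hence "norm (g \<theta>) * norm (\<psi> \<theta> ^ n) \<le> K * exp (- (c * u\<^sup>2))"
          using K[OF \<theta>(1)] \<open>K \<ge> 0\<close> by (intro mult_mono) auto
        thus ?thesis using \<theta>(1) True by (simp add: G_def F_def norm_mult flip: \<theta>_def)
      next
        case False
        thus ?thesis using \<open>K \<ge> 0\<close> by (auto simp: G_def F_def)
      qed
    qed
    show "AE u in lborel. (\<lambda>n. G n u) \<longlonglongrightarrow> complex_of_real (exp (- (a * u\<^sup>2)))"
    proof (rule AE_I2)
      fix u :: real
      have inv_sqrt: "(\<lambda>n. u / sqrt (real n)) \<longlonglongrightarrow> 0"
        by (intro tendsto_divide_0[OF tendsto_const] filterlim_at_top_imp_at_infinity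
            filterlim_compose[OF sqrt_at_top filterlim_real_sequentially])
      have in_I: "eventually (\<lambda>n. u / sqrt (real n) \<in> {-pi<..<pi}) sequentially"
        using filterlim_iff[THEN iffD1, OF inv_sqrt] nhd by blast
      have "(\<lambda>n. \<psi> (u / sqrt (real n)) ^ n) \<longlonglongrightarrow> of_real (exp (- (a * u\<^sup>2)))"
      proof (rule power_tendsto_exp)
        show "a * u\<^sup>2 \<ge> 0" using a by simp
        show "eventually (\<lambda>n. norm (\<psi> (u / sqrt (real n))) \<le> 1) sequentially"
          using in_I
        proof eventually_elim
          case (elim n)
          have "norm (\<psi> (u / sqrt (real n))) \<le> 1 - c * (u / sqrt (real n))\<^sup>2"
            using elim by (intro bound) auto
          also have "\<dots> \<le> 1" using c by simp
          finally show ?case .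
        qed
        show "(\<lambda>n. of_nat n * (\<psi> (u / sqrt (real n)) - 1)) \<longlonglongrightarrow> - of_real (a * u\<^sup>2)"
        \<comment> \<open>The hypothesis is a punctured limit at 0, so it applies only along
          arguments different from 0.\<close>
        proof (cases "u = 0")
          case True
          thus ?thesis by (simp add: \<psi>0)
        next
          case False
          have "filterlim (\<lambda>n. u / sqrt (real n)) (at 0) sequentially"
            unfolding filterlim_at using inv_sqrt False eventually_gt_at_top[of 0]
            by (auto elim!: eventually_mono)
          from filterlim_compose[OF lim this]
          have "(\<lambda>n. (\<psi> (u / sqrt (real n)) - 1) / of_real ((u / sqrt (real n))\<^sup>2) * of_real (u\<^sup>2))
             \<longlonglongrightarrow> - of_real a * of_real (u\<^sup>2)"
            by (intro tendsto_mult tendsto_const)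
          moreover have "eventually (\<lambda>n. (\<psi> (u / sqrt (real n)) - 1) /
              of_real ((u / sqrt (real n))\<^sup>2) * of_real (u\<^sup>2) =
              of_nat n * (\<psi> (u / sqrt (real n)) - 1)) sequentially"
            using eventually_gt_at_top[of 0]
          proof eventually_elim
            case (elim n)
            have "(u / sqrt (real n))\<^sup>2 = u\<^sup>2 / real n" by (simp add: power_divide)
            hence "complex_of_real ((u / sqrt (real n))\<^sup>2) = of_real (u\<^sup>2) / of_nat n"
              by (simp only: of_real_divide of_real_of_nat_eq)
            thus ?case using elim False by simp
          qed
          ultimately show ?thesis by (simp add: tendsto_cong)
        qed
      qed
      moreover have "isCont g 0"
        using cont(2) by (rule continuous_on_interior) (simp add: interior_atLeastAtMost_real)
      hence "(\<lambda>n. g (u / sqrt (real n))) \<longlonglongrightarrow> 1"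
        using isCont_tendsto_compose[OF _ inv_sqrt, of g] g0 by simp
      ultimately have "(\<lambda>n. g (u / sqrt (real n)) * \<psi> (u / sqrt (real n)) ^ n) \<longlonglongrightarrow>
          1 * of_real (exp (- (a * u\<^sup>2)))"
        by (intro tendsto_mult)
      moreover have "eventually (\<lambda>n. g (u / sqrt (real n)) * \<psi> (u / sqrt (real n)) ^ n = G n u) sequentially"
        using in_I eventually_gt_at_top[of 0] by eventually_elim (simp add: G_def F_def)
      ultimately show "(\<lambda>n. G n u) \<longlonglongrightarrow> complex_of_real (exp (- (a * u\<^sup>2)))"
        by (simp add: tendsto_cong)
    qed
  qed
  also have "(\<integral>u. complex_of_real (exp (- (a * u\<^sup>2))) \<partial>lborel) = of_real (sqrt (pi / a))"
    using gaussian_integral[OF a] by (simp add: has_bochner_integral_iff)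
  also have "eventually (\<lambda>n. (\<integral>u. G n u \<partial>lborel) =
     of_real (sqrt (real n)) * integral ?I (\<lambda>\<theta>. g \<theta> * \<psi> \<theta> ^ n)) sequentially"
    using eventually_gt_at_top[of 0]
  proof eventually_elim
    case (elim n)
    have "integral ?I (\<lambda>\<theta>. g \<theta> * \<psi> \<theta> ^ n) = (1 / sqrt (real n)) *\<^sub>R (\<integral>u. G n u \<partial>lborel)"
      unfolding int using lborel_integral_real_affine[of "1 / sqrt (real n)" "F n" 0] elim by (simp add: G_def)
    thus ?case using elim by (simp add: scaleR_conv_of_real field_simps)
  qed
  hence "((\<lambda>n. \<integral>u. G n u \<partial>lborel) \<longlonglongrightarrow> of_real (sqrt (pi / a))) \<longleftrightarrow>
     ((\<lambda>n. of_real (sqrt (real n)) * integral ?I (\<lambda>\<theta>. g \<theta> * \<psi> \<theta> ^ n)) \<longlonglongrightarrow> of_real (sqrt (pi / a)))"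
    by (rule tendsto_cong)
  finally show "(\<lambda>n. of_real (sqrt (real n)) * integral ?I (\<lambda>\<theta>. g \<theta> * \<psi> \<theta> ^ n)) \<longlonglongrightarrow>
      of_real (sqrt (pi / a))" .
qed

text \<open>With y = |x| / 2 \<le> 2, Taylor's formula gives sin y \<ge> y - y^3 / 6 \<ge> y / 3,
  and 1 - cos x is twice the square of sin y.\<close>

lemma one_minus_cos_ge:
  fixes x :: real assumes "\<bar>x\<bar> \<le> pi" shows "1 - cos x \<ge> x\<^sup>2 / 18"
proof (cases "x = 0")
  case False
  define y where "y = \<bar>x\<bar> / 2"
  have y: "y > 0" "y \<le> 2" using False assms pi_less_4 by (auto simp: y_def)
  obtain \<xi> where "sin y = (\<Sum>m<3. sin_coeff m * y ^ m) + (sin (\<xi> + 1/2 * real 3 * pi) / fact 3) * y ^ 3"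
    using Maclaurin_sin_expansion3[of 3 y] y(1) by auto
  hence "sin y = y + sin (\<xi> + 1/2 * real 3 * pi) * (y ^ 3 / 6)"
    by (simp add: numeral_3_eq_3 sin_coeff_def fact_numeral)
  moreover have "sin (\<xi> + 1/2 * real 3 * pi) * (y ^ 3 / 6) \<ge> (-1) * (y ^ 3 / 6)"
    using y(1) by (intro mult_right_mono) auto
  ultimately have "sin y \<ge> y - y ^ 3 / 6" by simp
  moreover have "y ^ 3 \<le> 4 * y"
    using mult_mono[OF y(2) y(2)] y(1) by (simp add: power3_eq_cube)
  ultimately have "sin y \<ge> y / 3" by linarith
  hence "(y / 3)\<^sup>2 \<le> (sin y)\<^sup>2" using y(1) by (intro power_mono) auto
  moreover have "cos x = 1 - 2 * (sin y)\<^sup>2"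
    using cos_double_sin[of y] by (simp add: y_def)
  ultimately show ?thesis by (simp add: y_def power_divide)
qed simp

section \<open>Complex power series of the reciprocal polynomial\<close>

definition complex_fps :: "real fps \<Rightarrow> complex fps" where
  "complex_fps f = Abs_fps (\<lambda>n. of_real (fps_nth f n))"

lemma complex_fps_mult: "complex_fps (f * g) = complex_fps f * complex_fps g"
  by (simp add: complex_fps_def fps_eq_iff fps_mult_nth)

lemma complex_fps_1: "complex_fps 1 = 1"
  by (simp add: complex_fps_def fps_eq_iff)

lemma complex_fps_power: "complex_fps (f ^ n) = complex_fps f ^ n"
  by (induction n) (simp_all add: complex_fps_1 complex_fps_mult)

lemma complex_fps_inverse:
  assumes "fps_nth f 0 \<noteq> 0"
  shows "complex_fps (inverse f) = inverse (complex_fps f)"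
proof -
  have "complex_fps f * complex_fps (inverse f) = 1"
    using assms by (simp add: inverse_mult_eq_1' complex_fps_1 flip: complex_fps_mult)
  thus ?thesis by (rule fps_inverse_unique[symmetric])
qed

abbreviation complex_poly :: "real poly \<Rightarrow> complex poly" where
  "complex_poly \<equiv> map_poly of_real"

lemma complex_fps_of_poly: "complex_fps (fps_of_poly A) = fps_of_poly (complex_poly A)"
  by (simp add: complex_fps_def fps_eq_iff coeff_map_poly)

lemma poly_complex_poly_of_real: "poly (complex_poly A) (of_real x) = of_real (poly A x)"
  by (induction A) (simp_all add: map_poly_pCons)

lemma inverse_poly_has_fps_expansion:
  assumes "coeff A 0 = 1"
  shows "(\<lambda>z. inverse (poly (complex_poly A) z)) has_fps_expansion 
    complex_fps (inverse (fps_of_poly A))"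
proof -
  have "eval_fps (fps_of_poly (complex_poly A)) has_fps_expansion fps_of_poly (complex_poly A)"
    by (rule eval_fps_has_fps_expansion) simp
  moreover have "eval_fps (fps_of_poly (complex_poly A)) = poly (complex_poly A)"
    by (rule ext) simp
  ultimately have "poly (complex_poly A) has_fps_expansion fps_of_poly (complex_poly A)"
    by simp
  hence "(\<lambda>z. inverse (poly (complex_poly A) z)) has_fps_expansion inverse (fps_of_poly (complex_poly A))"
    using assms by (intro has_fps_expansion_inverse) (simp_all add: coeff_map_poly)
  thus ?thesis using assms by (simp add: complex_fps_inverse complex_fps_of_poly)
qed

lemma inverse_poly_holomorphic:
  assumes "\<And>z. z \<in> S \<Longrightarrow> poly (complex_poly A) z \<noteq> 0"
  shows "(\<lambda>z. inverse (poly (complex_poly A) z)) holomorphic_on S"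
  using assms by (intro holomorphic_intros) auto

text \<open>Nonnegative coefficients of 1/A make the positive real point of each circle in a
  zero-free disc around 0 a maximum point of the modulus of 1/A.\<close>

locale positive_reciprocal =
  fixes A :: "real poly" and b :: "nat \<Rightarrow> real"
  defines "b \<equiv> \<lambda>n. fps_nth (inverse (fps_of_poly A)) n"
  assumes coeff_0: "coeff A 0 = 1" and b_nonneg: "b n \<ge> 0"
begin

lemma b_0: "b 0 = 1" by (simp add: b_def coeff_0)

context
  fixes R :: real
  assumes nonzero: "\<And>z. norm z < R \<Longrightarrow> poly (complex_poly A) z \<noteq> 0"
begin

lemma b_sums:
  assumes "norm z < R"
  shows "(\<lambda>n. of_real (b n) * z ^ n) sums inverse (poly (complex_poly A) z)"
proof -
  have "(\<lambda>z. inverse (poly (complex_poly A) z)) holomorphic_on eball 0 (ereal R)"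
    using nonzero by (intro inverse_poly_holomorphic) auto
  from has_fps_expansion_imp_sums_complex[OF inverse_poly_has_fps_expansion[OF coeff_0] this]
  show ?thesis using assms by (simp add: complex_fps_def b_def)
qed

lemma b_sums_real:
  assumes "0 \<le> x" "x < R"
  shows "(\<lambda>n. b n * x ^ n) sums inverse (poly A x)"
proof -
  have "(\<lambda>n. complex_of_real (b n * x ^ n)) sums of_real (inverse (poly A x))"
    using b_sums[of "of_real x"] assms by (simp add: poly_complex_poly_of_real)
  thus ?thesis unfolding sums_of_real_iff .
qed

text \<open>Terms of degree at least 2 are bounded by the triangle inequality, while those of degree
  0 and 1 are kept together. The resulting gap between \<open>1 + b 1 * norm z\<close> and
  \<open>norm (1 + of_real (b 1) * z)\<close> makes the maximum strict when \<open>b 1\<close> is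
  positive.\<close>

lemma norm_inverse_poly_le:
  assumes "norm z < R"
  shows "norm (inverse (poly (complex_poly A) z)) \<le>
    inverse (poly A (norm z)) - (1 + b 1 * norm z - norm (1 + of_real (b 1) * z))"
proof -
  let ?t = "norm z"
  have norm: "norm (of_real (b n) * z ^ n) = b n * ?t ^ n" for n
    using b_nonneg[of n] by (simp add: norm_mult norm_power)
  have cs: "(\<lambda>n. of_real (b (n + 2)) * z ^ (n + 2)) sums 
      (inverse (poly (complex_poly A) z) - (1 + of_real (b 1) * z))"
    using sums_split_initial_segment[OF b_sums[OF assms], of 2] by (simp add: b_0 numeral_2_eq_2)
  have rs: "(\<lambda>n. b (n + 2) * ?t ^ (n + 2)) sums (inverse (poly A ?t) - (1 + b 1 * ?t))"
    using sums_split_initial_segment[OF b_sums_real[OF _ assms], of 2] 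
    by (simp add: b_0 numeral_2_eq_2)
  have "norm (inverse (poly (complex_poly A) z) - (1 + of_real (b 1) * z)) \<le>
      inverse (poly A ?t) - (1 + b 1 * ?t)"
    using norm_suminf_le[of "\<lambda>n. of_real (b (n + 2)) * z ^ (n + 2)" "\<lambda>n. b (n + 2) * ?t ^ (n + 2)"]
      norm sums_summable[OF rs] sums_unique[OF rs] sums_unique[OF cs] by (metis order_refl)
  moreover have "norm (inverse (poly (complex_poly A) z)) \<le>
      norm (inverse (poly (complex_poly A) z) - (1 + of_real (b 1) * z)) + norm (1 + of_real (b 1) * z)"
    using norm_triangle_ineq[of "inverse (poly (complex_poly A) z) - (1 + of_real (b 1) * z)"
       "1 + of_real (b 1) * z"] by simp
  ultimately show ?thesis by linarith
qed

end

text \<open>A variant of Pringsheim's theorem: on approach to a zero \<open>y\<close> of minimal modulus,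
  \<open>1 / A\<close> would stay bounded by its values at the real point \<open>norm y\<close>.\<close>

lemma poly_nonzero:
  assumes pos: "\<And>x. 0 \<le> x \<Longrightarrow> x \<le> t \<Longrightarrow> poly A x > 0" and z: "norm z \<le> t"
  shows "poly (complex_poly A) z \<noteq> 0"
proof
  assume zero: "poly (complex_poly A) z = 0"
  define Z where "Z = {z. poly (complex_poly A) z = 0}"
  have "coeff (complex_poly A) 0 = 1" by (simp add: coeff_map_poly coeff_0)
  hence "complex_poly A \<noteq> 0" by force
  hence fin: "finite Z" unfolding Z_def by (rule poly_roots_finite)
  have "Z \<noteq> {}" using zero by (auto simp: Z_def)
  obtain y where y: "y \<in> Z" "\<And>w. w \<in> Z \<Longrightarrow> norm y \<le> norm w"
    using arg_min_if_finite[OF fin \<open>Z \<noteq> {}\<close>, of norm] by (meson not_le)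
  have yt: "norm y \<le> t" using y(2)[of z] zero z by (simp add: Z_def)
  have nz: "poly (complex_poly A) w \<noteq> 0" if "norm w < norm y" for w
    using y(2)[of w] that by (auto simp: Z_def)
  have "y \<noteq> 0" using y(1) by (auto simp: Z_def poly_0_coeff_0 coeff_map_poly coeff_0)
  have le: "poly A (l * norm y) \<le> norm (poly (complex_poly A) (of_real l * y))" if l: "0 < l" "l < 1" for l
  proof -
    define w where "w = of_real l * y"
    have w: "norm w = l * norm y" using l by (simp add: w_def norm_mult)
    have wy: "norm w < norm y" using l \<open>y \<noteq> 0\<close> by (simp add: w)
    have "norm (1 + of_real (b 1) * w) \<le> 1 + b 1 * norm w"
      using norm_triangle_ineq[of 1 "of_real (b 1) * w"] b_nonneg[of 1] by (simp add: norm_mult)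
    hence "norm (inverse (poly (complex_poly A) w)) \<le> inverse (poly A (norm w))"
      using norm_inverse_poly_le[of "norm y" w] nz wy by fastforce
    moreover have "poly A (norm w) > 0" using yt wy by (intro pos) auto
    moreover have "norm (poly (complex_poly A) w) > 0" using nz[OF wy] by simp
    ultimately show ?thesis unfolding w w_def[symmetric] by (simp add: norm_inverse)
  qed
  \<comment> \<open>Letting l tend to 1 along the radius gives A(|y|) \<le> |A(y)| = 0, although A
    is positive at |y|.\<close>
  have "((\<lambda>l. norm (poly (complex_poly A) (of_real l * y)) - poly A (l * norm y)) \<longlongrightarrow>
      norm (poly (complex_poly A) (of_real 1 * y)) - poly A (1 * norm y)) (at_left 1)"
    by (intro tendsto_intros)
  moreover have "eventually (\<lambda>l. l \<in> {0<..<1}) (at_left (1::real))"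
    by (rule eventually_at_left_real) simp
  hence "eventually (\<lambda>l. norm (poly (complex_poly A) (of_real l * y)) - poly A (l * norm y) \<ge> 0) (at_left 1)"
    by eventually_elim (use le in auto)
  ultimately have "norm (poly (complex_poly A) (of_real 1 * y)) - poly A (1 * norm y) \<ge> 0"
    by (rule tendsto_lowerbound) simp
  thus False using y(1) pos[of "norm y"] yt by (simp add: Z_def)
qed

text \<open>A has finitely many roots and none in the closed disc of radius t, so a slightly larger
  disc is free of them too. The entry \<open>t + 1\<close> in the minimum covers the case without
  roots.\<close>

lemma poly_nonzero_ball:
  assumes pos: "\<And>x. 0 \<le> x \<Longrightarrow> x \<le> t \<Longrightarrow> poly A x > 0"
  shows "\<exists>R>t. \<forall>z. norm z < R \<longrightarrow> poly (complex_poly A) z \<noteq> 0"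
proof -
  define Z where "Z = {z. poly (complex_poly A) z = 0}"
  have "coeff (complex_poly A) 0 = 1" by (simp add: coeff_map_poly coeff_0)
  hence "complex_poly A \<noteq> 0" by force
  hence fin: "finite Z" unfolding Z_def by (rule poly_roots_finite)
  define R where "R = Min (insert (t + 1) (norm ` Z))"
  have "norm z > t" if "z \<in> Z" for z
    using poly_nonzero[OF pos, of t z] that by (auto simp: Z_def not_le[symmetric])
  hence "R > t" unfolding R_def using fin by (subst Min_gr_iff) auto
  moreover have "poly (complex_poly A) z \<noteq> 0" if "norm z < R" for z
  proof
    assume "poly (complex_poly A) z = 0"
    hence "R \<le> norm z" unfolding R_def using fin by (intro Min_le) (auto simp: Z_def)
    thus False using that by simp
  qed
  ultimately show ?thesis by blast
qed

text \<open>With u = \<open>b 1 * t\<close>, the gap in \<open>norm_inverse_poly_le\<close> is at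
  least u (1 - cos \<theta>) / (1 + u), and 1 - cos \<theta> is at least \<theta>^2 / 18. The
  constant \<open>c\<close> collects these factors and A(t).\<close>

lemma norm_inverse_poly_circle_le:
  assumes pos: "\<And>x. 0 \<le> x \<Longrightarrow> x \<le> t \<Longrightarrow> poly A x > 0" and t: "t > 0" and b1: "b 1 > 0"
  shows "\<exists>c>0. \<forall>\<theta>\<in>{-pi..pi}. 
    norm (of_real (poly A t) * inverse (poly (complex_poly A) (of_real t * cis \<theta>))) \<le> 1 - c * \<theta>\<^sup>2"
proof -
  obtain R where R: "R > t" "\<And>z. norm z < R \<Longrightarrow> poly (complex_poly A) z \<noteq> 0"
    using poly_nonzero_ball[OF pos] by blast
  define u where "u = b 1 * t"
  have u: "u > 0" using b1 t by (simp add: u_def)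
  have Pt: "poly A t > 0" using pos t by simp
  define c where "c = poly A t * (u / (18 * (1 + u)))"
  have "c > 0" unfolding c_def using u Pt by simp
  moreover have "norm (of_real (poly A t) * inverse (poly (complex_poly A) (of_real t * cis \<theta>))) \<le> 
      1 - c * \<theta>\<^sup>2" if \<theta>: "\<theta> \<in> {-pi..pi}" for \<theta>
  proof -
    let ?z = "complex_of_real t * cis \<theta>"
    have nz: "norm ?z = t" using t by (simp add: norm_mult)
    \<comment> \<open>Chosen so that the square of |1 + u cis \<theta>| is (1 + u)^2 - 2 (1 + u) e,
      which is (1 + u - e)^2 up to the square of e.\<close>
    let ?e = "u * (1 - cos \<theta>) / (1 + u)"
    have e: "(1 + u) * ?e = u * (1 - cos \<theta>)" using u by simp
    have "(norm (1 + of_real (b 1) * ?z))\<^sup>2 = (1 + u * cos \<theta>)\<^sup>2 + (u * sin \<theta>)\<^sup>2"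
      by (simp add: cmod_power2 u_def mult.assoc)
    also have "\<dots> = 1 + 2 * u * cos \<theta> + u\<^sup>2 * ((sin \<theta>)\<^sup>2 + (cos \<theta>)\<^sup>2)"
      by algebra
    also have "\<dots> = (1 + u)\<^sup>2 - 2 * ((1 + u) * ?e)"
      unfolding e by (simp add: power2_eq_square algebra_simps)
    also have "\<dots> \<le> (1 + u - ?e)\<^sup>2"
    proof -
      have "(x - y)\<^sup>2 = x\<^sup>2 - 2 * (x * y) + y\<^sup>2" for x y :: real by algebra
      from this[of "1 + u" ?e] show ?thesis using zero_le_power2[of ?e] by linarith
    qed
    finally have sq: "(norm (1 + of_real (b 1) * ?z))\<^sup>2 \<le> (1 + u - ?e)\<^sup>2" .
    \<comment> \<open>The inequality 2 u \<le> (1 + u)^2 keeps 1 + u - e nonnegative, as taking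
      square roots requires.\<close>
    have "u * (1 - cos \<theta>) \<le> u * 2" using u cos_ge_minus_one[of \<theta>] by (intro mult_left_mono) auto
    also have "\<dots> \<le> (1 + u) * (1 + u)" using zero_le_square[of u] by (simp add: algebra_simps)
    finally have "?e \<le> 1 + u" using u by (simp add: pos_divide_le_eq)
    hence "norm (1 + of_real (b 1) * ?z) \<le> 1 + u - ?e"
      using sq by (intro power2_le_imp_le[OF sq]) simp
    hence "norm (inverse (poly (complex_poly A) ?z)) \<le> inverse (poly A t) - ?e"
      using norm_inverse_poly_le[of R ?z] R nz by (simp add: u_def)
    hence "poly A t * norm (inverse (poly (complex_poly A) ?z)) \<le> poly A t * (inverse (poly A t) - ?e)"
      using Pt by (intro mult_left_mono) auto
    also have "\<dots> = 1 - poly A t * (u / (1 + u)) * (1 - cos \<theta>)"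
      using Pt by (simp add: algebra_simps)
    also have "\<dots> \<le> 1 - poly A t * (u / (1 + u)) * (\<theta>\<^sup>2 / 18)"
      using one_minus_cos_ge[of \<theta>] \<theta> u Pt by (intro diff_left_mono mult_left_mono) auto
    also have "\<dots> = 1 - c * \<theta>\<^sup>2" using u by (simp add: c_def field_simps)
    finally show ?thesis using Pt by (simp add: norm_mult)
  qed
  ultimately show ?thesis by blast
qed

end

section \<open>Coefficients as integrals over a circle\<close>

lemma higher_deriv_circle_integral:
  fixes H :: "complex \<Rightarrow> complex"
  assumes holo: "H holomorphic_on ball 0 R" and t: "0 < t" "t < R"
  shows "integral {-pi..pi} (\<lambda>\<theta>. H (of_real t * cis \<theta>) / cis \<theta> ^ m) =
    of_real (2 * pi * t ^ m) * ((deriv ^^ m) H 0 / fact m)"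
proof -
  \<comment> \<open>\<open>circlepath\<close> runs over the angles from 0 to 2 pi. Passing from H(z)
    to H(-z) shifts them by pi, which puts the positive real point, the peak for Laplace's method,
    in the middle of the interval.\<close>
  define K :: "complex \<Rightarrow> complex" where "K z = H ((-1) * z)" for z
  have K_holo: "K holomorphic_on ball 0 R"
    unfolding K_def by (rule holomorphic_on_compose_gen[OF _ holo, unfolded o_def])
      (auto intro!: holomorphic_intros)
  have "K holomorphic_on cball 0 t" by (rule holomorphic_on_subset[OF K_holo]) (use t in auto)
  hence "(deriv ^^ m) K 0 = fact m / (2 * pi * \<i>) *
      contour_integral (circlepath 0 t) (\<lambda>u. K u / (u - 0) ^ Suc m)"
    using t by (intro Cauchy_higher_derivative_integral_circlepath(2))
      (auto intro: holomorphic_on_imp_continuous_on holomorphic_on_subset)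
  moreover have "(deriv ^^ m) K 0 = (-1) ^ m * (deriv ^^ m) H 0"
    unfolding K_def using t 
    by (subst higher_deriv_compose_linear[OF holo, of "ball 0 R"]) auto
  moreover have "contour_integral (circlepath 0 t) (\<lambda>u. K u / (u - 0) ^ Suc m) =
      \<i> * (-1) ^ m / of_real t ^ m * integral {-pi..pi} (\<lambda>\<theta>. H (of_real t * cis \<theta>) / cis \<theta> ^ m)"
  proof -
    define \<Phi> where "\<Phi> \<theta> = K (0 + t * cis \<theta>) / (0 + t * cis \<theta> - 0) ^ Suc m * t * \<i> * cis \<theta>" for \<theta>
    have "\<Phi> \<circ> (+) pi = (\<lambda>\<theta>. \<i> * (-1) ^ m / of_real t ^ m * (H (of_real t * cis \<theta>) / cis \<theta> ^ m))"
    proof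
      fix \<theta>
      have "cis (pi + \<theta>) = - cis \<theta>" by (simp add: complex_eq_iff)
      moreover have "(- 1 :: complex) ^ m * (-1) ^ m = 1" by (simp flip: power_mult_distrib)
      ultimately show "(\<Phi> \<circ> (+) pi) \<theta> = \<i> * (-1) ^ m / of_real t ^ m * (H (of_real t * cis \<theta>) / cis \<theta> ^ m)"
        using t(1) by (simp add: \<Phi>_def K_def power_mult_distrib field_simps power_minus')
    qed
    moreover have "contour_integral (circlepath 0 t) (\<lambda>u. K u / (u - 0) ^ Suc m) = integral {0..2 * pi} \<Phi>"
      unfolding circlepath_def \<Phi>_def by (subst contour_integral_part_circlepath_eq) auto
    moreover have "\<dots> = integral {-pi..pi} (\<Phi> \<circ> (+) pi)"
      by (subst integral_shift_Icc_real) simp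
    ultimately show ?thesis by (simp only: integral_mult_right)
  qed
  ultimately have "(-1) ^ m * (deriv ^^ m) H 0 = fact m / (2 * pi * \<i>) *
      (\<i> * (-1) ^ m / of_real t ^ m * integral {-pi..pi} (\<lambda>\<theta>. H (of_real t * cis \<theta>) / cis \<theta> ^ m))"
    by (simp only:)
  thus ?thesis using t(1) by (simp add: field_simps)
qed

lemma (in positive_reciprocal) coeff_inverse_power_integral:
  assumes pos: "\<And>x. 0 \<le> x \<Longrightarrow> x \<le> t \<Longrightarrow> poly A x > 0" and t: "t > 0"
  shows "integral {-pi..pi} (\<lambda>\<theta>. inverse (poly (complex_poly A) (of_real t * cis \<theta>)) ^ n / cis \<theta> ^ m) =
    of_real (2 * pi * t ^ m) * of_real (fps_nth (inverse (fps_of_poly A) ^ n) m)"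
proof -
  obtain R where R: "R > t" "\<And>z. norm z < R \<Longrightarrow> poly (complex_poly A) z \<noteq> 0"
    using poly_nonzero_ball[OF pos] by blast
  let ?H = "\<lambda>z. inverse (poly (complex_poly A) z) ^ n"
  have "?H holomorphic_on ball 0 R"
    using R(2) by (intro holomorphic_on_power inverse_poly_holomorphic) auto
  from higher_deriv_circle_integral[OF this t R(1), of m]
  have "integral {-pi..pi} (\<lambda>\<theta>. ?H (of_real t * cis \<theta>) / cis \<theta> ^ m) =
    of_real (2 * pi * t ^ m) * ((deriv ^^ m) ?H 0 / fact m)" .
  also have "(deriv ^^ m) ?H 0 / fact m = fps_nth (complex_fps (inverse (fps_of_poly A)) ^ n) m"
    by (rule fps_nth_fps_expansion[symmetric])
      (intro has_fps_expansion_power inverse_poly_has_fps_expansion coeff_0)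
  also have "\<dots> = of_real (fps_nth (inverse (fps_of_poly A) ^ n) m)"
    unfolding complex_fps_power[symmetric] by (simp add: complex_fps_def)
  finally show ?thesis .
qed

section \<open>Asymptotics\<close>

lemma complex_poly_add: "complex_poly (A + B) = complex_poly A + complex_poly B"
  by (simp add: poly_eq_iff coeff_map_poly)

lemma complex_poly_sum: "complex_poly (sum f S) = (\<Sum>k\<in>S. complex_poly (f k))"
  by (induction S rule: infinite_finite_induct) (simp_all add: complex_poly_add)

lemma complex_poly_pderiv: "complex_poly (pderiv A) = pderiv (complex_poly A)"
  by (simp add: poly_eq_iff coeff_map_poly coeff_pderiv)

definition q_poly :: "nat \<Rightarrow> nat \<Rightarrow> real poly" where
  "q_poly d p = (\<Sum>k\<le>d. monom ((-1) ^ k * real (d choose k)) (p ^ k))"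

lemma poly_q_poly: "poly (q_poly d p) z = q d p z"
  by (simp add: q_poly_def q_def poly_sum poly_monom atLeast0AtMost)

lemma deriv_q: "deriv (q d p) = poly (pderiv (q_poly d p))"
proof -
  have "q d p = poly (q_poly d p)" by (simp add: fun_eq_iff poly_q_poly)
  thus ?thesis using DERIV_imp_deriv[OF poly_DERIV] by fastforce
qed

lemma deriv2_q: "deriv (deriv (q d p)) = poly (pderiv (pderiv (q_poly d p)))"
  unfolding deriv_q using DERIV_imp_deriv[OF poly_DERIV] by fastforce

lemma complex_q_poly_eq:
  assumes "p \<ge> 1"
  shows "poly (complex_poly (q_poly d p)) z = z * poly (complex_poly (reduced_q d p)) (z ^ (p - 1))"
proof -
  have "z ^ p ^ k = z * (z ^ (p - 1)) ^ exponent p k" for k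
  proof -
    have "p ^ k = Suc ((p - 1) * exponent p k)"
      using exponent_eq[OF assms, of k] by (simp add: mult.commute)
    thus ?thesis by (simp only: power_Suc power_mult)
  qed
  thus ?thesis
    by (simp add: q_poly_def reduced_q_def complex_poly_sum map_poly_monom poly_sum poly_monom
        sum_distrib_left mult_ac)
qed

lemma q_eq_reduced_q:
  assumes "p \<ge> 1"
  shows "q d p x = x * poly (reduced_q d p) (x ^ (p - 1))"
proof -
  have "complex_of_real (q d p x) = of_real (x * poly (reduced_q d p) (x ^ (p - 1)))"
    using complex_q_poly_eq[OF assms, of d "of_real x"]
    by (simp add: poly_complex_poly_of_real poly_q_poly flip: of_real_power)
  thus ?thesis unfolding of_real_eq_iff .
qed

text \<open>The derivative of q is 1 at 0 and has no zero strictly between 0 and s, so by the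
  intermediate value theorem it stays positive there and q increases from q(0) = 0.\<close>

lemma q_pos:
  assumes p: "p \<ge> 2" and s: "smallest_critical_point (q d p) s" and z: "0 < z" "z \<le> s"
  shows "q d p z > 0"
proof -
  let ?q' = "pderiv (q_poly d p)"
  have crit: "poly ?q' x \<noteq> 0" if "0 < x" "x < s" for x
    using s that unfolding smallest_critical_point_def deriv_q by force
  have "poly ?q' 0 = coeff (q_poly d p) 1" by (simp add: poly_0_coeff_0 coeff_pderiv)
  also have "\<dots> = (\<Sum>k\<le>d. if k = 0 then 1 else 0)"
    unfolding q_poly_def coeff_sum
  proof (rule sum.cong)
    fix k
    have "p ^ k = 1 \<longleftrightarrow> k = 0" using p by (simp add: power_eq_1_iff)
    thus "coeff (monom ((-1) ^ k * real (d choose k)) (p ^ k)) 1 = (if k = 0 then 1 else 0)"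
      by simp
  qed simp
  finally have q'0: "poly ?q' 0 > 0" by simp
  have pos: "poly ?q' x > 0" if x: "0 < x" "x < s" for x
  proof (rule ccontr)
    assume "\<not> poly ?q' x > 0"
    hence "poly ?q' x < 0" using crit[OF x] by simp
    from poly_IVT_neg[OF x(1) q'0 this] obtain y where "0 < y" "y < x" "poly ?q' y = 0" by blast
    thus False using crit[of y] x by simp
  qed
  have "poly (q_poly d p) 0 < poly (q_poly d p) z"
  proof (rule DERIV_pos_imp_increasing_open[OF z(1)])
    fix x assume "0 < x" "x < z"
    thus "\<exists>y. (poly (q_poly d p) has_real_derivative y) (at x) \<and> 0 < y"
      using pos[of x] z poly_DERIV by (intro exI[of _ "poly ?q' x"]) auto
  qed (intro continuous_intros)
  moreover have "q d p 0 = 0" using q_eq_reduced_q[of p d 0] p by simp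
  ultimately show ?thesis by (simp add: poly_q_poly)
qed

text \<open>For x = z^(p-1) with z > 0, the sign of A(x) is that of q(z) = z A(x). This says nothing
  at x = 0, where A(0) = 1.\<close>

lemma reduced_q_pos:
  assumes p: "p \<ge> 2" and s: "smallest_critical_point (q d p) s"
    and x: "0 \<le> x" "x \<le> s ^ (p - 1)"
  shows "poly (reduced_q d p) x > 0"
proof (cases "x = 0")
  case True
  thus ?thesis using fps_of_poly_reduced_q_0[of p d] p by (simp add: poly_0_coeff_0)
next
  case False
  define z where "z = root (p - 1) x"
  have s0: "s > 0" using s by (simp add: smallest_critical_point_def)
  have z: "z ^ (p - 1) = x" "z > 0" using x False p by (auto simp: z_def real_root_pow_pos2)
  have "z \<le> s"
    using x(2) z s0 p power_mono_iff[of z s "p - 1"] by simp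
  hence "z * poly (reduced_q d p) x > 0"
    using q_pos[OF p s z(2)] q_eq_reduced_q[of p d z] p z(1) by simp
  thus ?thesis using z(2) by (simp add: zero_less_mult_iff)
qed

section \<open>Local expansion of a polynomial along the circle\<close>

lemma poly_second_order:
  fixes B :: "complex poly"
  shows "((\<lambda>w. (poly B (s + w) - poly B s - poly (pderiv B) s * w) / w\<^sup>2) \<longlongrightarrow>
    poly (pderiv (pderiv B)) s / 2) (at 0)"
proof -
  \<comment> \<open>Recentring at \<open>s\<close> and peeling off two coefficients displays the
    value, the first derivative and a remainder \<open>E\<close> for which 2 E(0) is the second
    derivative.\<close>
  define D where "D = pcompose B [:s, 1:]"
  obtain a D' where D: "D = pCons a D'" by (cases D)
  obtain b E where D': "D' = pCons b E" by (cases D')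
  have pd: "pderiv D = pcompose (pderiv B) [:s, 1:]" 
      "pderiv (pderiv D) = pcompose (pderiv (pderiv B)) [:s, 1:]"
    by (simp_all add: D_def pderiv_pcompose pderiv_pCons)
  have val: "poly B (s + w) = a + w * (b + w * poly E w)" for w
    using poly_pcompose[of B "[:s, 1:]" w] D D' by (simp add: D_def)
  have "poly (pderiv B) s = poly (pderiv D) 0" by (simp add: pd poly_pcompose)
  hence b: "poly (pderiv B) s = b" by (simp add: D D' pderiv_pCons)
  have "poly (pderiv (pderiv B)) s = poly (pderiv (pderiv D)) 0"
    unfolding pd(2) by (simp add: poly_pcompose)
  hence E: "poly (pderiv (pderiv B)) s = 2 * poly E 0" by (simp add: D D' pderiv_pCons pderiv_add)
  have "((\<lambda>w. poly E w) \<longlongrightarrow> poly E 0) (at 0)" by (intro tendsto_intros)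
  moreover have "eventually (\<lambda>w. poly E w = 
      (poly B (s + w) - poly B s - poly (pderiv B) s * w) / w\<^sup>2) (at 0)"
    using eventually_neq_at_within[of 0]
  proof eventually_elim
    case (elim w)
    thus ?case using val[of w] val[of 0] b by (simp add: field_simps power2_eq_square)
  qed
  ultimately show ?thesis unfolding E by (simp add: tendsto_cong)
qed

lemma cis_first_order:
  assumes "r \<noteq> 0"
  shows "((\<lambda>\<theta>. (cis (\<theta> / r) - 1) / of_real \<theta>) \<longlongrightarrow> \<i> / of_real r) (at 0)"
proof -
  have "((\<lambda>z. exp (\<i> * z / of_real r)) has_field_derivative exp (\<i> * 0 / of_real r) * (\<i> / of_real r)) (at 0)"
    using assms by (auto intro!: derivative_eq_intros)
  hence "((\<lambda>z. (exp (\<i> * z / of_real r) - 1) / z) \<longlongrightarrow> \<i> / of_real r) (at 0)"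
    by (simp add: DERIV_def)
  moreover have "filterlim complex_of_real (at 0) (at 0)"
    unfolding filterlim_at using tendsto_of_real[OF tendsto_ident_at, of 0]
    by (auto simp: eventually_at_filter)
  ultimately have "((\<lambda>\<theta>. (exp (\<i> * of_real \<theta> / of_real r) - 1) / of_real \<theta>) \<longlongrightarrow> \<i> / of_real r) (at 0)"
    by (rule filterlim_compose)
  thus ?thesis by (simp add: cis_conv_exp)
qed

text \<open>A point of the circle is s + w with w asymptotic to i s \<theta> / r. The linear term
  vanishes because s is critical, and w^2, asymptotic to - s^2 \<theta>^2 / r^2, produces the minus
  sign.\<close>

lemma poly_circle_second_order:
  fixes B :: "complex poly" and s r :: real
  assumes s: "s > 0" and r: "r > 0" and crit: "poly (pderiv B) (of_real s) = 0"
  shows "((\<lambda>\<theta>. (poly B (of_real s * cis (\<theta> / r)) - poly B (of_real s)) / of_real (\<theta>\<^sup>2)) \<longlongrightarrow>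
    - (poly (pderiv (pderiv B)) (of_real s) * of_real (s\<^sup>2 / (2 * r\<^sup>2)))) (at 0)"
proof -
  define w where "w \<theta> = complex_of_real s * (cis (\<theta> / r) - 1)" for \<theta>
  have lim: "((\<lambda>\<theta>. w \<theta> / of_real \<theta>) \<longlongrightarrow> of_real s * (\<i> / of_real r)) (at 0)"
    using tendsto_mult[OF tendsto_const[of "complex_of_real s"] cis_first_order[of r]] r by (simp add: w_def)
  hence "eventually (\<lambda>\<theta>. w \<theta> / of_real \<theta> \<noteq> 0) (at 0)"
    by (rule tendsto_imp_eventually_ne) (use s r in auto)
  hence ne: "eventually (\<lambda>\<theta>. w \<theta> \<noteq> 0) (at 0)" by (auto elim: eventually_mono)
  have "(w \<longlongrightarrow> of_real s * (cis (0 / r) - 1)) (at 0)"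
    unfolding w_def using r by (intro tendsto_intros) auto
  hence "filterlim w (at 0) (at 0)"
    using ne by (simp add: filterlim_at)
  from filterlim_compose[OF poly_second_order[of B "of_real s"] this]
  have "((\<lambda>\<theta>. (poly B (of_real s + w \<theta>) - poly B (of_real s)) / (w \<theta>)\<^sup>2) \<longlongrightarrow>
      poly (pderiv (pderiv B)) (of_real s) / 2) (at 0)"
    by (simp add: crit)
  from tendsto_mult[OF this tendsto_power[OF lim, of 2]]
  have "((\<lambda>\<theta>. (poly B (of_real s + w \<theta>) - poly B (of_real s)) / (w \<theta>)\<^sup>2 * (w \<theta> / of_real \<theta>)\<^sup>2) \<longlongrightarrow>
      - (poly (pderiv (pderiv B)) (of_real s) * of_real (s\<^sup>2 / (2 * r\<^sup>2)))) (at 0)"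
    by (simp add: power_mult_distrib power_divide)
  moreover have "eventually (\<lambda>\<theta>. (poly B (of_real s + w \<theta>) - poly B (of_real s)) / (w \<theta>)\<^sup>2 * (w \<theta> / of_real \<theta>)\<^sup>2
     = (poly B (of_real s * cis (\<theta> / r)) - poly B (of_real s)) / of_real (\<theta>\<^sup>2)) (at 0)"
    using ne
  proof eventually_elim
    case (elim \<theta>)
    have "of_real s + w \<theta> = of_real s * cis (\<theta> / r)" by (simp add: w_def algebra_simps)
    thus ?case using elim by (simp add: power_divide)
  qed
  ultimately show ?thesis by (simp add: tendsto_cong)
qed

theorem theorem10:
  fixes d p :: nat and s :: real
  assumes "d \<ge> 1" and "p \<ge> 2"
    and "smallest_critical_point (q d p) s"
  shows "((\<lambda>n. real (C d p n) /
            ((real p - 1) / sqrt (- 2 * pi * deriv (deriv (q d p)) s)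
              * real n powr (- 3 / 2) * q d p s powr (1 / 2 - real n))) \<longlongrightarrow> 1)
         (inf at_top (principal {n. [n = 1] (mod (p - 1))}))"
proof -
  define r where "r = p - 1"
  have r: "r > 0" "real r = real p - 1" using assms(2) by (auto simp: r_def)
  define A where "A = reduced_q d p"
  define t where "t = s ^ r"
  have s: "s > 0" using assms(3) by (simp add: smallest_critical_point_def)
  have t: "t > 0" using s by (simp add: t_def)
  interpret positive_reciprocal A "\<lambda>n. fps_nth (inverse (fps_of_poly A)) n"
    using fps_of_poly_reduced_q_0[of p d] inverse_reduced_q_nonneg[of p d] assms(2)
    by unfold_locales (auto simp: A_def)
  have pos: "poly A x > 0" if "0 \<le> x" "x \<le> t" for x
    using reduced_q_pos[OF assms(2,3)] that by (simp add: A_def t_def r_def)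
  define qs where "qs = q d p s"
  have qs: "qs = s * poly A t" "qs > 0"
    using q_eq_reduced_q[of p d s] assms(2) q_pos[OF assms(2,3) s] by (auto simp: qs_def A_def t_def r_def)
  define q2 where "q2 = deriv (deriv (q d p)) s"
  \<comment> \<open>The number with q(s) / q(s cis(\<theta> / r)) = 1 - a \<theta>^2 + o(\<theta>^2)
    at 0.\<close>
  define a where "a = - (s\<^sup>2 * q2) / (2 * qs * (real r)\<^sup>2)"
  \<comment> \<open>For n = 1 + m r the factor 1 / cis(\<theta>)^m equals cis(\<theta> / r) cis(-
    \<theta> / r)^n. The coefficient integrand is thus, up to a constant, a fixed amplitude
    \<open>g\<close> times an exact \<open>n\<close>-th power of \<open>\<psi>\<close>.\<close>
  define g where "g \<theta> = cis (\<theta> / real r)" for \<theta>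
  define \<psi> where "\<psi> \<theta> = of_real (poly A t) * inverse (poly (complex_poly A) (of_real t * cis \<theta>)) *
    cis (- (\<theta> / real r))" for \<theta>
  obtain c where c: "c > 0" "\<forall>\<theta>\<in>{-pi..pi}. 
      norm (of_real (poly A t) * inverse (poly (complex_poly A) (of_real t * cis \<theta>))) \<le> 1 - c * \<theta>\<^sup>2"
    using norm_inverse_poly_circle_le[of t, OF pos t] inverse_reduced_q_1[of p d] assms(1,2) 
    by (auto simp: A_def)
  have nz: "poly (complex_poly A) (of_real t * cis \<theta>) \<noteq> 0" for \<theta>
    using poly_nonzero[of t, OF pos] t by (simp add: norm_mult)
  let ?B = "complex_poly (q_poly d p)"
  \<comment> \<open>In the variable z = s cis(\<theta> / r), \<open>\<psi>\<close> is q(s) / q(z);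
    in this form q'(s) = 0 makes \<theta> = 0 a stationary point.\<close>
  have \<psi>_eq: "\<psi> \<theta> = of_real qs / poly ?B (of_real s * cis (\<theta> / real r))" for \<theta>
  proof -
    have "(of_real s * cis (\<theta> / real r)) ^ r = of_real t * cis \<theta>"
      using r(1) by (simp add: power_mult_distrib t_def Complex.DeMoivre)
    hence "poly ?B (of_real s * cis (\<theta> / real r)) = 
        of_real s * cis (\<theta> / real r) * poly (complex_poly A) (of_real t * cis \<theta>)"
      using complex_q_poly_eq[of p d] assms(2) by (simp add: A_def r_def)
    thus ?thesis using s nz[of \<theta>] qs(1)
      by (simp add: \<psi>_def cis_divide field_simps flip: cis_inverse)
  qed
  have Bs: "poly ?B (of_real s) = of_real qs"
    by (simp add: poly_complex_poly_of_real poly_q_poly qs_def)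
  have crit: "poly (pderiv ?B) (of_real s) = 0"
    using assms(3) unfolding smallest_critical_point_def deriv_q
    by (simp add: poly_complex_poly_of_real flip: complex_poly_pderiv)
  have B2: "poly (pderiv (pderiv ?B)) (of_real s) = of_real q2"
    by (simp add: poly_complex_poly_of_real q2_def deriv2_q flip: complex_poly_pderiv)
  have lim: "((\<lambda>\<theta>. (\<psi> \<theta> - 1) / of_real (\<theta>\<^sup>2)) \<longlongrightarrow> - of_real a) (at 0)"
  proof -
    let ?f = "\<lambda>\<theta>. poly ?B (of_real s * cis (\<theta> / real r))"
    have "(?f \<longlongrightarrow> poly ?B (of_real s * cis (0 / real r))) (at 0)"
      using r(1) by (intro tendsto_intros) auto
    hence f: "(?f \<longlongrightarrow> of_real qs) (at 0)" by (simp add: Bs)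
    have "((\<lambda>\<theta>. - ((?f \<theta> - of_real qs) / of_real (\<theta>\<^sup>2)) / ?f \<theta>) \<longlongrightarrow>
      - (- (of_real q2 * of_real (s\<^sup>2 / (2 * (real r)\<^sup>2)))) / of_real qs) (at 0)"
      using poly_circle_second_order[OF s _ crit, of "real r"] r qs(2) f
      unfolding Bs B2 by (intro tendsto_intros) auto
    moreover have "- (- (complex_of_real q2 * of_real (s\<^sup>2 / (2 * (real r)\<^sup>2)))) / of_real qs = - of_real a"
      by (simp add: a_def mult_ac)
    moreover have "- ((?f \<theta> - of_real qs) / of_real (\<theta>\<^sup>2)) / ?f \<theta> = (\<psi> \<theta> - 1) / of_real (\<theta>\<^sup>2)" for \<theta>
    proof -
      have "?f \<theta> \<noteq> 0"
        using \<psi>_eq[of \<theta>] nz[of \<theta>] pos[of t] t by (auto simp: \<psi>_def)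
      moreover have "- ((x - y) / z) / x = (y / x - 1) / z" if "x \<noteq> 0" for x y z :: complex
        using that by (cases "z = 0") (simp_all add: field_simps)
      ultimately show ?thesis unfolding \<psi>_eq by blast
    qed
    ultimately show ?thesis by (simp only:)
  qed
  have laplace: "a > 0"
    "(\<lambda>n. of_real (sqrt (real n)) * integral {-pi..pi} (\<lambda>\<theta>. g \<theta> * \<psi> \<theta> ^ n)) \<longlonglongrightarrow> of_real (sqrt (pi / a))"
  proof -
    have cont: "continuous_on {-pi..pi} \<psi>" "continuous_on {-pi..pi} g"
      unfolding \<psi>_def g_def using nz r by (auto intro!: continuous_intros)
    have "norm (\<psi> \<theta>) \<le> 1 - c * \<theta>\<^sup>2" if "\<theta> \<in> {-pi..pi}" for \<theta>
      using c(2) that by (simp add: \<psi>_def norm_mult)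
    moreover have "\<psi> 0 = 1" using qs(2) Bs by (simp add: \<psi>_eq)
    ultimately show "a > 0" "(\<lambda>n. of_real (sqrt (real n)) * integral {-pi..pi} (\<lambda>\<theta>. g \<theta> * \<psi> \<theta> ^ n)) 
        \<longlonglongrightarrow> of_real (sqrt (pi / a))"
      using laplace_circle[OF cont _ c(1) _ _ lim] by (auto simp: g_def)
  qed
  \<comment> \<open>The reciprocal of sqrt (pi / a), written in the quantities of the asymptotic
    formula.\<close>
  define \<kappa> where "\<kappa> = s * sqrt (- 2 * pi * q2) / (2 * pi * real r * sqrt qs)"
  \<comment> \<open>Laplace's method has given a > 0, and this fixes the sign of q''(s).\<close>
  have q2: "q2 < 0"
  proof (rule ccontr)
    assume "\<not> q2 < 0"
    hence "s\<^sup>2 * q2 / (2 * qs * (real r)\<^sup>2) \<ge> 0" using qs(2) by simp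
    thus False using laplace(1) by (simp add: a_def)
  qed
  have \<kappa>: "sqrt (pi / a) * \<kappa> = 1"
  proof -
    have "pi / a = (real r / s)\<^sup>2 * (2 * pi * qs / (- q2))"
      using s r(1) qs(2) q2 by (simp add: a_def field_simps)
    hence "sqrt (pi / a) = sqrt ((real r / s)\<^sup>2) * sqrt (2 * pi * qs / (- q2))"
      by (simp only: real_sqrt_mult)
    also have "sqrt ((real r / s)\<^sup>2) = real r / s" using s by simp
    finally have "sqrt (pi / a) = real r / s * sqrt (2 * pi * qs / (- q2))" .
    hence "sqrt (pi / a) * \<kappa> = sqrt (2 * pi * qs / (- q2)) * sqrt (- 2 * pi * q2) / (2 * pi * sqrt qs)"
      using s r(1) by (simp add: \<kappa>_def)
    also have "sqrt (2 * pi * qs / (- q2)) * sqrt (- 2 * pi * q2) = sqrt ((2 * pi)\<^sup>2 * qs)"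
      unfolding real_sqrt_mult[symmetric] using q2 by (simp add: power2_eq_square field_simps)
    also have "\<dots> / (2 * pi * sqrt qs) = 1"
      using qs(2) by (simp add: real_sqrt_mult)
    finally show ?thesis .
  qed
  \<comment> \<open>The integral makes sense for every n, so \<open>\<Phi>\<close> converges along
    all n; it is compared with the ratio of the theorem only for n congruent to 1.\<close>
  define \<Phi> where "\<Phi> n = sqrt (real n) * Re (integral {-pi..pi} (\<lambda>\<theta>. g \<theta> * \<psi> \<theta> ^ n)) * \<kappa>" for n
  have "\<Phi> \<longlonglongrightarrow> sqrt (pi / a) * \<kappa>"
    unfolding \<Phi>_def using tendsto_Re[OF laplace(2)] by (intro tendsto_mult tendsto_const) simp
  hence \<Phi>: "\<Phi> \<longlonglongrightarrow> 1" by (simp add: \<kappa>)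
  have eq: "\<Phi> n = real (C d p n) / ((real p - 1) / sqrt (- 2 * pi * deriv (deriv (q d p)) s)
      * real n powr (- 3 / 2) * q d p s powr (1 / 2 - real n))"
    if n: "n > 0" "[n = 1] (mod (p - 1))" for n
  proof -
    obtain m where m: "n = 1 + m * r"
      using n cong_to_1'_nat[of n "p - 1"] by (auto simp: r_def)
    let ?C = "real (C d p n)"
    have coeff: "fps_nth (inverse (fps_of_poly A) ^ n) m = real n * ?C"
      using fps_coeff_eq_if_functional_equation[OF assms(2) _ C_functional_equation[OF assms(2)], of d n m]
        C_0[of d p] m by (simp add: A_def r_def)
    have "g \<theta> * \<psi> \<theta> ^ n = of_real (poly A t ^ n) *
        (inverse (poly (complex_poly A) (of_real t * cis \<theta>)) ^ n / cis \<theta> ^ m)" for \<theta>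
    proof -
      have "cis (\<theta> / real r) * cis (- (\<theta> / real r)) ^ n = cis (\<theta> / real r - real n * (\<theta> / real r))"
        by (simp add: Complex.DeMoivre cis_mult)
      also have "\<theta> / real r - real n * (\<theta> / real r) = - (real m * \<theta>)"
        using r(1) by (simp add: m field_simps)
      also have "cis \<dots> = inverse (cis \<theta> ^ m)" by (simp add: Complex.DeMoivre cis_inverse)
      finally show ?thesis
        by (simp add: g_def \<psi>_def power_mult_distrib divide_inverse mult_ac)
    qed
    hence "integral {-pi..pi} (\<lambda>\<theta>. g \<theta> * \<psi> \<theta> ^ n) = of_real (poly A t ^ n) *
        integral {-pi..pi} (\<lambda>\<theta>. inverse (poly (complex_poly A) (of_real t * cis \<theta>)) ^ n / cis \<theta> ^ m)"
      by (simp only: integral_mult_right)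
    also have "\<dots> = of_real (poly A t ^ n) * (of_real (2 * pi * t ^ m) * of_real (real n * ?C))"
      by (simp only: coeff_inverse_power_integral[of t, OF pos t] coeff)
    finally have "integral {-pi..pi} (\<lambda>\<theta>. g \<theta> * \<psi> \<theta> ^ n) =
      of_real (poly A t ^ n * (2 * pi * t ^ m) * (real n * ?C))" 
      by (simp only: of_real_mult mult.assoc)
    hence Re: "Re (integral {-pi..pi} (\<lambda>\<theta>. g \<theta> * \<psi> \<theta> ^ n)) = 
        2 * pi * (poly A t ^ n * t ^ m) * (real n * ?C)"
      by (simp only: Re_complex_of_real mult_ac)
    \<comment> \<open>From q(s) = s A(t) and s^n = s t^m.\<close>
    have tm: "qs ^ n = s * (t ^ m * poly A t ^ n)"
    proof -
      have "t ^ m * s = s ^ n" by (simp add: t_def m mult.commute flip: power_mult)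
      thus ?thesis using s by (simp add: qs(1) power_mult_distrib field_simps)
    qed
    have pow: "real n powr (- 3 / 2) = 1 / (real n * sqrt (real n))"
    proof -
      have "real n powr (- 3 / 2) = real n powr (- 1) * real n powr (- (1 / 2))"
        unfolding powr_add[symmetric] by simp
      thus ?thesis using n(1) by (simp add: powr_minus powr_half_sqrt field_simps)
    qed
    have "qs powr (1 / 2 - real n) = sqrt qs / qs ^ n"
      using qs(2) by (simp add: powr_diff powr_half_sqrt powr_realpow)
    hence "?C / ((real p - 1) / sqrt (- 2 * pi * deriv (deriv (q d p)) s)
        * real n powr (- 3 / 2) * q d p s powr (1 / 2 - real n)) =
      ?C / (real r / sqrt (- 2 * pi * q2) * (1 / (real n * sqrt (real n))) * (sqrt qs / qs ^ n))"
      by (simp only: pow r(2) qs_def[symmetric] q2_def[symmetric])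
    also have "\<dots> = \<Phi> n"
      using r(1) n(1) qs(2) q2 s by (simp add: \<Phi>_def \<kappa>_def Re tm field_simps)
    finally show ?thesis ..
  qed
  have "eventually (\<lambda>n. \<Phi> n = real (C d p n) / ((real p - 1) / sqrt (- 2 * pi * deriv (deriv (q d p)) s)
      * real n powr (- 3 / 2) * q d p s powr (1 / 2 - real n)))
      (inf at_top (principal {n. [n = 1] (mod (p - 1))}))"
    unfolding eventually_inf_principal using eventually_gt_at_top[of 0]
    by eventually_elim (use eq in auto)
  moreover have "(\<Phi> \<longlongrightarrow> 1) (inf at_top (principal {n. [n = 1] (mod (p - 1))}))"
    by (rule tendsto_mono[OF inf_le1 \<Phi>])
  ultimately show ?thesis by (simp add: tendsto_cong)
qed

end
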